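(* For every real $m\ge 1$ and $R>0$, $$\lambda_m(R)\ge\kappa_m,\qquad\text{where}\qquad \kappa_m=1-\frac2m\,\frac{\Gamma(\frac{m+1}{2})^2}{\Gamma(\frac m2)^2}.$$ Moreover, for every real $m\ge1$, $$\lim_{R\to\infty}\lambda_m(R)=\kappa_m .$$ The supremum in the definition of $\lambda_m(R)$ is attained for every $R>0$ (and every real $m\ge1$).
   Context: For real $m\ge1$ and $R>0$ put $w_m(r)=r^m e^{-r^2/2}$, $W_{m,R}=\int_0^R w_m(r)\,dr$, and let $\mu_{m,R}$ be the probability measure $d\mu_{m,R}(r)=\frac{w_m(r)}{W_{m,R}}\,dr$ on $(0,R)$. Write $\mathbb E_{m,R}\phi=\int_0^R\phi\,d\mu_{m,R}$ and $\mathrm{Var}_{m,R}(\phi)=\mathbb E_{m,R}[(\phi-\mathbb E_{m,R}\phi)^2]$. The space $H^1((0,R),w_m\,dr)$ consists of the real functions $v\in H^1_{\mathrm{loc}}((0,R))$ with $\int_0^R(v^2+v'^2)w_m\,dr<\infty$. For such $v$ set $(Tv)(r)=rv(r)-v'(r)$. For $g\in L^2((0,R),w_m\,dr)$ with $\mathbb E_{m,R}g=1$ and $v\in H^1((0,R),w_m\,dr)$ define $$\Phi_{m,R}(g,v)=\mathbb E_{m,R}\Big[v'^2+v^2+\frac{(g+Tv)^2}{m}\Big]-\mathrm{Var}_{m,R}(g),$$ and $$\lambda_m(R)=\sup_{\substack{g\in L^2((0,R),w_m\,dr)\\ \mathbb E_{m,R}g=1}}\ \inf_{v\in H^1((0,R),w_m\,dr)}\Phi_{m,R}(g,v).$$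 *)

theory Defs
  imports "HOL-Analysis.Analysis"
begin

text \<open>Functions on \<open>(0,R)\<close> are rendered as functions \<open>real \<Rightarrow> real\<close> whose values outside \<open>(0,R)\<close>
  never matter: every measurability and integrability condition refers to
  \<open>lebesgue_on {0<..<R}\<close>. Elements of \<open>L\<^sup>2\<close> and \<open>H\<^sup>1\<close> are represented by functions, not by
  almost-everywhere classes.\<close>

definition weight :: "real \<Rightarrow> real \<Rightarrow> real" where
  "weight m r = r powr m * exp (- r\<^sup>2 / 2)"

definition total_weight :: "real \<Rightarrow> real \<Rightarrow> real" where
  "total_weight m R = (\<integral>r. weight m r \<partial>lebesgue_on {0<..<R})"

definition mu :: "real \<Rightarrow> real \<Rightarrow> real measure" where
  "mu m R = density (lebesgue_on {0<..<R}) (\<lambda>r. ennreal (weight m r / total_weight m R))"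

definition expect :: "real \<Rightarrow> real \<Rightarrow> (real \<Rightarrow> real) \<Rightarrow> real" where
  "expect m R \<phi> = (\<integral>r. \<phi> r \<partial>mu m R)"

definition var :: "real \<Rightarrow> real \<Rightarrow> (real \<Rightarrow> real) \<Rightarrow> real" where
  "var m R \<phi> = expect m R (\<lambda>r. (\<phi> r - expect m R \<phi>)\<^sup>2)"

definition L2 :: "real \<Rightarrow> real \<Rightarrow> (real \<Rightarrow> real) set" where
  "L2 m R = {g \<in> borel_measurable (lebesgue_on {0<..<R}).
     integrable (lebesgue_on {0<..<R}) (\<lambda>r. (g r)\<^sup>2 * weight m r)}"

definition L1_loc :: "real \<Rightarrow> (real \<Rightarrow> real) set" where
  "L1_loc R = {f \<in> borel_measurable (lebesgue_on {0<..<R}).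
     \<forall>K. compact K \<and> K \<subseteq> {0<..<R} \<longrightarrow> integrable (lebesgue_on K) f}"

definition L2_loc :: "real \<Rightarrow> (real \<Rightarrow> real) set" where
  "L2_loc R = {f \<in> borel_measurable (lebesgue_on {0<..<R}).
     \<forall>K. compact K \<and> K \<subseteq> {0<..<R} \<longrightarrow> integrable (lebesgue_on K) (\<lambda>r. (f r)\<^sup>2)}"

text \<open>The space \<open>C\<^sub>c\<^sup>\<infinity>((0,R))\<close>, each function being extended by zero to the real line.\<close>

definition test_functions :: "real \<Rightarrow> (real \<Rightarrow> real) set" where
  "test_functions R = {\<phi>. (\<forall>k x. ((deriv ^^ k) \<phi>) field_differentiable (at x)) \<and>
     compact (closure {x. \<phi> x \<noteq> 0}) \<and> closure {x. \<phi> x \<noteq> 0} \<subseteq> {0<..<R}}"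

definition has_weak_derivative :: "real \<Rightarrow> (real \<Rightarrow> real) \<Rightarrow> (real \<Rightarrow> real) \<Rightarrow> bool" where
  "has_weak_derivative R v d \<longleftrightarrow> v \<in> L1_loc R \<and> d \<in> L1_loc R \<and>
     (\<forall>\<phi>\<in>test_functions R.
        (\<integral>r. v r * deriv \<phi> r \<partial>lebesgue_on {0<..<R}) = - (\<integral>r. d r * \<phi> r \<partial>lebesgue_on {0<..<R}))"

text \<open>A weak derivative is unique up to null sets, and all uses below are insensitive to the
  choice of representative.\<close>

definition weak_deriv :: "real \<Rightarrow> (real \<Rightarrow> real) \<Rightarrow> real \<Rightarrow> real" where
  "weak_deriv R v = (SOME d. has_weak_derivative R v d)"

definition H1_loc :: "real \<Rightarrow> (real \<Rightarrow> real) set" where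
  "H1_loc R = {v \<in> L2_loc R. \<exists>d \<in> L2_loc R. has_weak_derivative R v d}"

definition H1 :: "real \<Rightarrow> real \<Rightarrow> (real \<Rightarrow> real) set" where
  "H1 m R = {v \<in> H1_loc R.
     integrable (lebesgue_on {0<..<R}) (\<lambda>r. ((v r)\<^sup>2 + (weak_deriv R v r)\<^sup>2) * weight m r)}"

definition T :: "real \<Rightarrow> (real \<Rightarrow> real) \<Rightarrow> real \<Rightarrow> real" where
  "T R v r = r * v r - weak_deriv R v r"

definition Phi :: "real \<Rightarrow> real \<Rightarrow> (real \<Rightarrow> real) \<Rightarrow> (real \<Rightarrow> real) \<Rightarrow> real" where
  "Phi m R g v =
     expect m R (\<lambda>r. (weak_deriv R v r)\<^sup>2 + (v r)\<^sup>2 + (g r + T R v r)\<^sup>2 / m) - var m R g"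

definition admissible :: "real \<Rightarrow> real \<Rightarrow> (real \<Rightarrow> real) set" where
  "admissible m R = {g \<in> L2 m R. expect m R g = 1}"

text \<open>The supremum and the infimum are taken in the extended reals, so that no boundedness
  needs to be presupposed.\<close>

definition inf_Phi :: "real \<Rightarrow> real \<Rightarrow> (real \<Rightarrow> real) \<Rightarrow> ereal" where
  "inf_Phi m R g = (INF v\<in>H1 m R. ereal (Phi m R g v))"

definition lambda :: "real \<Rightarrow> real \<Rightarrow> ereal" where
  "lambda m R = (SUP g\<in>admissible m R. inf_Phi m R g)"

definition kappa :: "real \<Rightarrow> real" where
  "kappa m = 1 - 2 / m * ((Gamma ((m + 1) / 2))\<^sup>2 / (Gamma (m / 2))\<^sup>2)"

end

theory Submission
  imports Defs "HOL-Real_Asymp.Real_Asymp"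
begin

text \<open>Write \<open>w\<close> for the weight. For \<open>m \<ge> 1\<close> the functional \<open>\<Phi>(g,v)\<close> is concave in \<open>g\<close> (on \<open>E g = 1\<close>) and
  convex in \<open>v\<close>, so its sup-inf is the value at a saddle point, and a saddle point can be written
  down explicitly. Let \<open>c\<close> be the Lagrange multiplier of the constraint and \<open>h = g - c\<close>. Stationarity
  in \<open>g\<close> reads \<open>T v = m h - g\<close>; stationarity in \<open>v\<close> reads \<open>(w (v' - h))' = w (v + r h)\<close>, with
  the natural boundary condition that the flux \<open>q = w (v' - h)\<close> vanishes at \<open>0\<close> and at \<open>R\<close>. With
  \<open>W(r) = \<integral>\<^sub>0\<^sup>r w(s) ds\<close> and \<open>F(r) = \<integral>\<^sub>0\<^sup>r w(s)/s ds\<close>, the solutions that are regular at \<open>0\<close> are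
  \<open>h = (c F + b W)/w\<close>, \<open>v = b + r h\<close>. The condition \<open>q(R) = 0\<close> fixes \<open>b/c\<close>, the condition
  \<open>E g = 1\<close> fixes \<open>c\<close>, and the value of \<open>\<Phi>\<close> at this point is \<open>1 - c\<close>. Completing squares on both
  sides shows that it is a saddle point (\<open>Phi_saddle_v_le\<close>, \<open>Phi_saddle_g_ge\<close>), which gives
  \<open>\<lambda>\<^sub>m(R) = 1 - c\<close> and the attainment of the supremum at once (\<open>lambda_eq\<close>, \<open>inf_Phi_saddle_g\<close>).

  The weak form of the equation for \<open>v\<close> has to be tested against all of \<open>H\<^sup>1\<close>, whose members are
  given through weak derivatives only. Since \<open>q\<close> is smooth inside \<open>(0,R)\<close> and vanishes at the ends,
  \<open>q\<close> times a cutoff is itself a test function, and the cutoff can be removed by dominated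
  convergence (\<open>H1_integral_by_parts\<close>). That \<open>v\<close> lies in \<open>H\<^sup>1\<close> needs the uniqueness of weak
  derivatives (\<open>has_weak_derivative_unique\<close>).

  Let \<open>I = \<integral>\<^sub>0\<^sup>r W\<close>, \<open>K = \<integral>\<^sub>0\<^sup>r F\<close> and \<open>\<beta> = r I + m K\<close>. The closed form of the constant is
  \<open>1/c = 1 + (m K\<^sup>2 - I\<^sup>2)/(W \<beta>)\<close>, evaluated at \<open>R\<close>. It is nonincreasing in \<open>R\<close> (\<open>inv_gap_antimono\<close>): its
  derivative is \<open>w/W\<close> times the difference between the boundary energy \<open>(m K\<^sup>2 + I\<^sup>2)/\<beta>\<^sup>2\<close> at \<open>R\<close> and
  the weighted mean of the same quantity over \<open>(0,R)\<close>, and the boundary energy is nonincreasing. As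
  \<open>R \<rightarrow> \<infinity>\<close>, \<open>1/c\<close> tends to \<open>m F(\<infinity>)\<^sup>2/W(\<infinity>)\<^sup>2\<close>, a quotient of Gamma values that equals
  \<open>1/(1 - \<kappa>\<^sub>m)\<close> (\<open>inv_gap_tendsto\<close>). So \<open>1 - c\<close> decreases to \<open>\<kappa>\<^sub>m\<close>.\<close>

section \<open>Smooth functions and cutoffs\<close>

text \<open>Keeping the order \<open>k\<close> as a parameter turns all closure properties into inductions on \<open>k\<close>: the
  derivative of a product, a composition or a reciprocal is again of the same shape, with one order
  less to check. A function is smooth on \<open>U\<close> when this holds for every \<open>k\<close>.\<close>

definition smooth_upto :: "nat \<Rightarrow> real set \<Rightarrow> (real \<Rightarrow> real) \<Rightarrow> bool" where
  "smooth_upto k U f \<longleftrightarrow> (\<forall>j<k. \<forall>x\<in>U. ((deriv ^^ j) f) field_differentiable (at x))"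

lemma smooth_upto_0 [simp]: "smooth_upto 0 U f"
  by (simp add: smooth_upto_def)

lemma smooth_upto_Suc:
  "smooth_upto (Suc k) U f \<longleftrightarrow> (\<forall>x\<in>U. f field_differentiable (at x)) \<and> smooth_upto k U (deriv f)"
proof -
  have "(\<forall>j<Suc k. P j) \<longleftrightarrow> P 0 \<and> (\<forall>j<k. P (Suc j))" for P
    by (auto simp: less_Suc_eq_0_disj)
  then show ?thesis
    by (simp add: smooth_upto_def funpow_Suc_right del: funpow.simps(2))
qed

lemma smooth_upto_SucD: "smooth_upto (Suc k) U f \<Longrightarrow> smooth_upto k U f"
  by (simp add: smooth_upto_def)

lemma smooth_upto_subset: "smooth_upto k V f \<Longrightarrow> U \<subseteq> V \<Longrightarrow> smooth_upto k U f"
  by (auto simp: smooth_upto_def)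

lemma smooth_upto_Un: "smooth_upto k U f \<Longrightarrow> smooth_upto k V f \<Longrightarrow> smooth_upto k (U \<union> V) f"
  by (auto simp: smooth_upto_def)

lemma smooth_upto_cong:
  assumes "open U" "smooth_upto k U g" "\<And>x. x \<in> U \<Longrightarrow> f x = g x"
  shows "smooth_upto k U f"
proof -
  have "(deriv ^^ j) f field_differentiable (at x)" if "j < k" "x \<in> U" for j x
  proof -
    have ev: "\<forall>\<^sub>F y in nhds x. (deriv ^^ j) g y = (deriv ^^ j) f y"
      using eventually_nhds_in_open[OF assms(1) that(2)]
    proof eventually_elim
      case (elim y)
      have "\<forall>\<^sub>F z in nhds y. g z = f z"
        using eventually_nhds_in_open[OF assms(1) elim] by eventually_elim (simp add: assms(3))
      then show ?case by (intro higher_deriv_cong_ev) auto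
    qed
    have "((deriv ^^ j) g) field_differentiable (at x)"
      using assms(2) that by (simp add: smooth_upto_def)
    then obtain D where "((deriv ^^ j) g has_field_derivative D) (at x)"
      by (auto simp: field_differentiable_def)
    then have "((deriv ^^ j) f has_field_derivative D) (at x)"
      using DERIV_cong_ev[OF refl ev refl] by simp
    then show ?thesis by (auto simp: field_differentiable_def)
  qed
  then show ?thesis by (simp add: smooth_upto_def)
qed

lemma smooth_upto_SucI:
  assumes "open U" "\<And>x. x \<in> U \<Longrightarrow> (f has_real_derivative f' x) (at x)" "smooth_upto k U f'"
  shows "smooth_upto (Suc k) U f"
  unfolding smooth_upto_Suc
proof
  show "\<forall>x\<in>U. f field_differentiable at x"
    using assms(2) by (auto simp: field_differentiable_def)
  show "smooth_upto k U (deriv f)"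
    by (rule smooth_upto_cong[OF assms(1,3)]) (simp add: DERIV_imp_deriv assms(2))
qed

lemma smooth_upto_const [simp]: "smooth_upto k U (\<lambda>x. c)"
  by (induction k arbitrary: c) (auto simp: smooth_upto_Suc)

lemma smooth_upto_ident [simp]: "smooth_upto k U (\<lambda>x. x)"
proof (cases k)
  case (Suc j)
  have "smooth_upto (Suc j) UNIV (\<lambda>x. x)"
    by (rule smooth_upto_SucI[where f'="\<lambda>x. 1"]) auto
  then show ?thesis using Suc by (auto intro: smooth_upto_subset)
qed simp

lemma smooth_upto_has_derivative:
  assumes "smooth_upto (Suc k) U f" "x \<in> U"
  shows "(f has_real_derivative deriv f x) (at x)"
  using assms field_differentiable_derivI by (auto simp: smooth_upto_Suc)

lemma smooth_upto_deriv: "smooth_upto (Suc k) U f \<Longrightarrow> smooth_upto k U (deriv f)"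
  by (simp add: smooth_upto_Suc)

lemma smooth_upto_add:
  assumes "open U" "smooth_upto k U f" "smooth_upto k U g"
  shows "smooth_upto k U (\<lambda>x. f x + g x)"
  using assms(2,3)
proof (induction k arbitrary: f g)
  case (Suc k)
  note f = Suc.prems(1) and g = Suc.prems(2)
  show ?case
    by (rule smooth_upto_SucI[OF assms(1) DERIV_add])
       (rule smooth_upto_has_derivative[OF f] smooth_upto_has_derivative[OF g]
         Suc.IH[OF smooth_upto_deriv[OF f] smooth_upto_deriv[OF g]] | assumption)+
qed simp

lemma smooth_upto_mult:
  assumes "open U" "smooth_upto k U f" "smooth_upto k U g"
  shows "smooth_upto k U (\<lambda>x. f x * g x)"
  using assms(2,3)
proof (induction k arbitrary: f g)
  case (Suc k)
  note f = Suc.prems(1) and g = Suc.prems(2)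
  have "smooth_upto k U (\<lambda>x. deriv f x * g x + deriv g x * f x)"
    by (rule smooth_upto_add[OF assms(1) Suc.IH[OF smooth_upto_deriv[OF f] smooth_upto_SucD[OF g]]
          Suc.IH[OF smooth_upto_deriv[OF g] smooth_upto_SucD[OF f]]])
  moreover have "((\<lambda>x. f x * g x) has_real_derivative deriv f x * g x + deriv g x * f x) (at x)"
    if "x \<in> U" for x
    by (rule DERIV_mult[OF smooth_upto_has_derivative[OF f that] smooth_upto_has_derivative[OF g that]])
  ultimately show ?case
    by (intro smooth_upto_SucI[OF assms(1)])
qed simp

lemma smooth_upto_uminus:
  assumes "open U" "smooth_upto k U f"
  shows "smooth_upto k U (\<lambda>x. - f x)"
  using smooth_upto_mult[OF assms(1) smooth_upto_const[of k U "-1"] assms(2)] by simp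

lemma smooth_upto_diff:
  assumes "open U" "smooth_upto k U f" "smooth_upto k U g"
  shows "smooth_upto k U (\<lambda>x. f x - g x)"
  using smooth_upto_add[OF assms(1,2) smooth_upto_uminus[OF assms(1,3)]] by simp

lemma smooth_upto_compose:
  assumes "open U" "open V" "smooth_upto k U f" "smooth_upto k V g" "f ` U \<subseteq> V"
  shows "smooth_upto k U (\<lambda>x. g (f x))"
  using assms(3-5)
proof (induction k arbitrary: f g)
  case (Suc k)
  note f = Suc.prems(1) and g = Suc.prems(2) and sub = Suc.prems(3)
  have "smooth_upto k U (\<lambda>x. deriv g (f x) * deriv f x)"
    by (rule smooth_upto_mult[OF assms(1) Suc.IH[OF smooth_upto_SucD[OF f] smooth_upto_deriv[OF g] sub]
          smooth_upto_deriv[OF f]])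
  moreover have "((\<lambda>x. g (f x)) has_real_derivative deriv g (f x) * deriv f x) (at x)" if "x \<in> U" for x
    using smooth_upto_has_derivative[OF g, of "f x"] smooth_upto_has_derivative[OF f that] sub that
    by (intro DERIV_chain2) auto
  ultimately show ?case
    by (intro smooth_upto_SucI[OF assms(1)])
qed simp

lemma smooth_upto_inverse: "smooth_upto k (- {0}) inverse"
proof (induction k)
  case (Suc k)
  show ?case
  proof (rule smooth_upto_SucI)
    show "smooth_upto k (- {0}) (\<lambda>x. - (inverse x * inverse x))"
      by (intro smooth_upto_uminus smooth_upto_mult Suc open_Compl closed_singleton)
    show "(inverse has_real_derivative - (inverse x * inverse x)) (at x)" if "x \<in> - {0}" for x :: real
      using DERIV_inverse[of x UNIV] that by (simp add: power2_eq_square numeral_2_eq_2)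
  qed auto
qed simp

lemma smooth_upto_divide:
  assumes "open U" "smooth_upto k U f" "smooth_upto k U g" "\<And>x. x \<in> U \<Longrightarrow> g x \<noteq> 0"
  shows "smooth_upto k U (\<lambda>x. f x / g x)"
proof -
  have "smooth_upto k U (\<lambda>x. inverse (g x))"
    by (rule smooth_upto_compose[OF assms(1) _ assms(3) smooth_upto_inverse]) (use assms(4) in auto)
  then have "smooth_upto k U (\<lambda>x. f x * inverse (g x))"
    by (rule smooth_upto_mult[OF assms(1,2)])
  then show ?thesis unfolding divide_inverse .
qed

lemma smooth_upto_exp: "smooth_upto k U (exp :: real \<Rightarrow> real)"
proof -
  have "smooth_upto k UNIV (exp :: real \<Rightarrow> real)"
  proof (induction k)
    case (Suc k)
    show ?case by (rule smooth_upto_SucI[OF open_UNIV DERIV_exp Suc])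
  qed simp
  then show ?thesis by (rule smooth_upto_subset) simp
qed

lemma smooth_upto_powr: "smooth_upto k {0<..} (\<lambda>x. x powr p)"
proof (induction k arbitrary: p)
  case (Suc k)
  show ?case
  proof (rule smooth_upto_SucI)
    show "smooth_upto k {0<..} (\<lambda>x. p * x powr (p - 1))"
      by (intro smooth_upto_mult smooth_upto_const Suc open_greaterThan)
  qed (auto intro: has_real_derivative_powr)
qed simp

text \<open>For \<open>n = 0\<close> this is the standard smooth function that is flat at \<open>0\<close>. The whole family is needed because
  differentiation leads from \<open>n\<close> to a combination of \<open>n + 1\<close> and \<open>n + 2\<close>.\<close>

definition flat_exp :: "nat \<Rightarrow> real \<Rightarrow> real" where
  "flat_exp n x = (if x \<le> 0 then 0 else (1 / x) ^ n * exp (- 1 / x))"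

lemma flat_exp_has_derivative:
  "(flat_exp n has_real_derivative (flat_exp (n + 2) x - real n * flat_exp (n + 1) x)) (at x)"
proof -
  consider "x < 0" | "x > 0" | "x = 0" by linarith
  then show ?thesis
  proof cases
    case 1
    have "((\<lambda>x. 0) has_real_derivative 0) (at x)" by simp
    then have "(flat_exp n has_real_derivative 0) (at x)"
      by (rule has_field_derivative_transform_within_open[where S="{..<0}"]) (use 1 in \<open>auto simp: flat_exp_def\<close>)
    with 1 show ?thesis by (simp add: flat_exp_def)
  next
    case 2
    have 1: "((\<lambda>x. 1 / x) has_real_derivative - (1 / x)\<^sup>2) (at x)"
      using 2 by (auto intro!: derivative_eq_intros simp: power2_eq_square)
    have "real n * (- (1 / x)\<^sup>2 * (1 / x) ^ (n - Suc 0)) = - real n * (1 / x) ^ (n + 1)"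
      by (cases n) (simp_all add: power2_eq_square algebra_simps diff_divide_distrib add_divide_distrib)
    with DERIV_power[OF 1, of n]
    have pow: "((\<lambda>x. (1 / x) ^ n) has_real_derivative - real n * (1 / x) ^ (n + 1)) (at x)"
      by (simp only:)
    have ex: "((\<lambda>x. exp (- 1 / x)) has_real_derivative (1 / x)\<^sup>2 * exp (- 1 / x)) (at x)"
      using 2 by (auto intro!: derivative_eq_intros simp: power2_eq_square)
    have "- real n * (1 / x) ^ (n + 1) * exp (- 1 / x) + (1 / x)\<^sup>2 * exp (- 1 / x) * (1 / x) ^ n
        = flat_exp (n + 2) x - real n * flat_exp (n + 1) x"
      using 2 by (simp add: flat_exp_def power_add power2_eq_square ac_simps)
    with DERIV_mult[OF pow ex]
    have "((\<lambda>x. (1 / x) ^ n * exp (- 1 / x)) has_real_derivative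
        (flat_exp (n + 2) x - real n * flat_exp (n + 1) x)) (at x)"
      by (simp only:)
    then show ?thesis
      by (rule has_field_derivative_transform_within_open[where S="{0<..}"]) (use 2 in \<open>auto simp: flat_exp_def\<close>)
  next
    case 3
    have "((\<lambda>h. flat_exp (Suc n) h) \<longlongrightarrow> 0) (at_right 0)"
    proof -
      have "((\<lambda>t::real. t ^ Suc n / exp t) \<longlongrightarrow> 0) at_top" by (rule tendsto_power_div_exp_0)
      then have "((\<lambda>h::real. (inverse h) ^ Suc n / exp (inverse h)) \<longlongrightarrow> 0) (at_right 0)"
        by (rule filterlim_compose[OF _ filterlim_inverse_at_top_right])
      then show ?thesis
        by (rule Lim_transform_eventually)
           (rule eventually_at_rightI[of 0 1], simp_all add: flat_exp_def exp_minus field_simps)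
    qed
    moreover have "((\<lambda>h. flat_exp (Suc n) h) \<longlongrightarrow> 0) (at_left 0)"
      by (rule tendsto_eventually) (auto simp: flat_exp_def eventually_at_left_field intro: exI[of _ "-1"])
    ultimately have "((\<lambda>h. flat_exp (Suc n) h) \<longlongrightarrow> 0) (at 0)"
      by (simp add: filterlim_split_at)
    then have "((\<lambda>h. (flat_exp n (0 + h) - flat_exp n 0) / h) \<longlongrightarrow> 0) (at 0)"
      by (rule Lim_transform_eventually) (auto simp: flat_exp_def eventually_at_filter)
    then show ?thesis using 3 by (simp add: DERIV_def flat_exp_def)
  qed
qed

lemma smooth_upto_flat_exp: "smooth_upto k UNIV (flat_exp n)"
proof (induction k arbitrary: n)
  case (Suc k)
  have "smooth_upto k UNIV (\<lambda>x. flat_exp (n + 2) x - real n * flat_exp (n + 1) x)"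
    by (rule smooth_upto_diff[OF open_UNIV Suc smooth_upto_mult[OF open_UNIV smooth_upto_const Suc]])
  then show ?case
    by (rule smooth_upto_SucI[OF open_UNIV flat_exp_has_derivative])
qed simp

definition smooth_step :: "real \<Rightarrow> real" where
  "smooth_step x = flat_exp 0 x / (flat_exp 0 x + flat_exp 0 (1 - x))"

lemma flat_exp_nonneg: "flat_exp 0 x \<ge> 0" by (simp add: flat_exp_def)

lemma flat_exp_sum_pos: "flat_exp 0 x + flat_exp 0 (1 - x) > 0"
  by (cases "x \<le> 0") (auto simp: flat_exp_def add_pos_pos)

lemma smooth_step_bounds: "0 \<le> smooth_step x" "smooth_step x \<le> 1"
  using flat_exp_sum_pos[of x] flat_exp_nonneg[of x] flat_exp_nonneg[of "1 - x"]
  by (auto simp: smooth_step_def)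

lemma smooth_step_eq_0: "x \<le> 0 \<Longrightarrow> smooth_step x = 0"
  by (simp add: smooth_step_def flat_exp_def)

lemma smooth_step_eq_1: "x \<ge> 1 \<Longrightarrow> smooth_step x = 1"
  by (simp add: smooth_step_def flat_exp_def)

lemma smooth_upto_smooth_step: "smooth_upto k UNIV smooth_step"
proof -
  have "smooth_upto k UNIV (\<lambda>x. flat_exp 0 (1 - x))"
    by (rule smooth_upto_compose[OF _ _ _ smooth_upto_flat_exp])
       (auto intro!: smooth_upto_diff)
  then have "smooth_upto k UNIV (\<lambda>x. flat_exp 0 x / (flat_exp 0 x + flat_exp 0 (1 - x)))"
    by (intro smooth_upto_divide smooth_upto_add smooth_upto_flat_exp open_UNIV)
       (auto simp: less_imp_neq[OF flat_exp_sum_pos, symmetric])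
  then show ?thesis unfolding smooth_step_def[abs_def] .
qed

lemma smooth_step_has_derivative: "(smooth_step has_real_derivative deriv smooth_step x) (at x)"
  by (rule smooth_upto_has_derivative[OF smooth_upto_smooth_step[of "Suc 0"]]) simp

lemma continuous_deriv_smooth_step: "continuous_on A (deriv smooth_step)"
proof -
  have "smooth_upto (Suc 0) UNIV (deriv smooth_step)"
    by (rule smooth_upto_deriv[OF smooth_upto_smooth_step])
  then show ?thesis
    using DERIV_continuous_on smooth_upto_has_derivative
    by (metis UNIV_I DERIV_isCont continuous_at_imp_continuous_on)
qed

lemma deriv_smooth_step_eq_0:
  assumes "x < 0 \<or> x > 1" shows "deriv smooth_step x = 0"
proof -
  have "(smooth_step has_real_derivative 0) (at x)"
  proof (cases "x < 0")
    case True
    have "((\<lambda>x. 0) has_real_derivative 0) (at x)" by simp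
    then show ?thesis
      by (rule has_field_derivative_transform_within_open[where S="{..<0}"])
         (use True in \<open>auto simp: smooth_step_eq_0\<close>)
  next
    case False
    have "((\<lambda>x. 1) has_real_derivative 0) (at x)" by simp
    then show ?thesis
      by (rule has_field_derivative_transform_within_open[where S="{1<..}"])
         (use False assms in \<open>auto simp: smooth_step_eq_1\<close>)
  qed
  then show ?thesis by (rule DERIV_imp_deriv)
qed

lemma deriv_smooth_step_bounded:
  obtains C where "C > 0" "\<And>x. \<bar>deriv smooth_step x\<bar> \<le> C"
proof -
  have "compact (deriv smooth_step ` {0..1})"
    by (intro compact_continuous_image continuous_deriv_smooth_step) simp
  then obtain C where C: "C > 0" "\<And>x. x \<in> {0..1} \<Longrightarrow> \<bar>deriv smooth_step x\<bar> \<le> C"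
    by (auto simp: bounded_pos dest!: compact_imp_bounded)
  have "\<bar>deriv smooth_step x\<bar> \<le> C" for x
    using C deriv_smooth_step_eq_0[of x] by (cases "x \<in> {0..1}") auto
  with C(1) show ?thesis by (rule that)
qed

text \<open>A plateau function on \<open>(a,b)\<close>: it vanishes within distance \<open>1/n\<close> of the endpoints and equals
  \<open>1\<close> at distance \<open>2/n\<close> and more.\<close>

definition cutoff :: "real \<Rightarrow> real \<Rightarrow> nat \<Rightarrow> real \<Rightarrow> real" where
  "cutoff a b n x = smooth_step (real n * (x - a) - 1) * smooth_step (real n * (b - x) - 1)"

lemma cutoff_bounds: "0 \<le> cutoff a b n x" "cutoff a b n x \<le> 1"
  by (auto simp: cutoff_def smooth_step_bounds mult_le_one)

lemma cutoff_eq_0: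
  assumes "x \<le> a + 1 / Suc n \<or> x \<ge> b - 1 / Suc n"
  shows "cutoff a b (Suc n) x = 0"
proof -
  have "real (Suc n) * (x - a) - 1 \<le> 0 \<or> real (Suc n) * (b - x) - 1 \<le> 0"
    using assms by (auto simp: field_simps)
  then show ?thesis by (auto simp: cutoff_def smooth_step_eq_0)
qed

lemma cutoff_eq_0_outside:
  assumes "\<not> (a < x \<and> x < b)"
  shows "cutoff a b (Suc n) x = 0"
proof -
  have "1 / real (Suc n) > 0" by simp
  then show ?thesis using assms by (intro cutoff_eq_0) linarith
qed

lemma smooth_upto_cutoff: "smooth_upto k UNIV (cutoff a b n)"
proof -
  have "smooth_upto k UNIV (\<lambda>x. smooth_step (real n * (x - a) - 1))"
    by (rule smooth_upto_compose[OF _ _ _ smooth_upto_smooth_step])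
       (auto intro!: smooth_upto_diff smooth_upto_mult)
  moreover have "smooth_upto k UNIV (\<lambda>x. smooth_step (real n * (b - x) - 1))"
    by (rule smooth_upto_compose[OF _ _ _ smooth_upto_smooth_step])
       (auto intro!: smooth_upto_diff smooth_upto_mult)
  ultimately have "smooth_upto k UNIV (\<lambda>x. smooth_step (real n * (x - a) - 1) * smooth_step (real n * (b - x) - 1))"
    by (rule smooth_upto_mult[OF open_UNIV])
  then show ?thesis unfolding cutoff_def[abs_def] .
qed

lemma cutoff_has_derivative:
  "(cutoff a b n has_real_derivative deriv (cutoff a b n) x) (at x)"
  by (rule smooth_upto_has_derivative[OF smooth_upto_cutoff[of "Suc 0"]]) simp

lemma deriv_cutoff:
  "deriv (cutoff a b n) x = real n * deriv smooth_step (real n * (x - a) - 1) * smooth_step (real n * (b - x) - 1)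
     - real n * deriv smooth_step (real n * (b - x) - 1) * smooth_step (real n * (x - a) - 1)"
proof -
  have 1: "((\<lambda>x. smooth_step (real n * (x - a) - 1)) has_real_derivative
      deriv smooth_step (real n * (x - a) - 1) * real n) (at x)"
    by (rule DERIV_chain2[OF smooth_step_has_derivative]) (auto intro!: derivative_eq_intros)
  have 2: "((\<lambda>x. smooth_step (real n * (b - x) - 1)) has_real_derivative
      deriv smooth_step (real n * (b - x) - 1) * (- real n)) (at x)"
    by (rule DERIV_chain2[OF smooth_step_has_derivative]) (auto intro!: derivative_eq_intros)
  from DERIV_mult[OF 1 2] show ?thesis
    unfolding cutoff_def[abs_def] by (intro DERIV_imp_deriv) (simp add: algebra_simps)
qed

lemma cutoff_eventually_1:
  assumes "a < x" "x < b"
  shows "\<forall>\<^sub>F n in sequentially. cutoff a b (Suc n) x = 1 \<and> deriv (cutoff a b (Suc n)) x = 0"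
proof -
  have "\<forall>\<^sub>F n in sequentially. real n > 2 / (x - a)" "\<forall>\<^sub>F n in sequentially. real n > 2 / (b - x)"
    using filterlim_real_sequentially by (auto simp: filterlim_at_top_dense)
  then have "\<forall>\<^sub>F n in sequentially. cutoff a b n x = 1 \<and> deriv (cutoff a b n) x = 0"
  proof eventually_elim
    case (elim n)
    then have "real n * (x - a) - 1 > 1" "real n * (b - x) - 1 > 1"
      using assms by (auto simp: field_simps)
    then show ?case
      by (simp add: cutoff_def deriv_cutoff smooth_step_eq_1 deriv_smooth_step_eq_0)
  qed
  then show ?thesis
    using eventually_sequentially_Suc[of "\<lambda>n. cutoff a b n x = 1 \<and> deriv (cutoff a b n) x = 0"] by simp
qed

text \<open>The derivative has size \<open>n\<close>, but it is nonzero only where \<open>n\<close> is at most twice the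
  reciprocal of the distance to an endpoint. The resulting bound does not depend on \<open>n\<close>, so that it can
  serve in dominated convergence against functions that vanish at the endpoints.\<close>

lemma deriv_cutoff_bounded:
  obtains C where "C > 0"
    "\<And>a b n x. a < x \<Longrightarrow> x < b \<Longrightarrow> \<bar>deriv (cutoff a b n) x\<bar> \<le> C * (1 / (x - a) + 1 / (b - x))"
proof -
  obtain C where C: "C > 0" "\<And>x. \<bar>deriv smooth_step x\<bar> \<le> C"
    using deriv_smooth_step_bounded by metis
  \<comment> \<open>The factor \<open>n\<close> does no harm: the derivative vanishes as soon as \<open>n y > 2\<close>.\<close>
  have scale: "\<bar>real n * deriv smooth_step (real n * y - 1)\<bar> \<le> C * (2 / y)" if "y > 0" for n y
  proof (cases "real n * y \<le> 2")
    case True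
    then have "real n \<le> 2 / y" using that by (simp add: field_simps)
    then have "real n * \<bar>deriv smooth_step (real n * y - 1)\<bar> \<le> (2 / y) * C"
      using C that by (intro mult_mono) auto
    then show ?thesis by (simp add: abs_mult mult.commute)
  next
    case False
    then show ?thesis using C(1) that by (simp add: deriv_smooth_step_eq_0)
  qed
  have "\<bar>deriv (cutoff a b n) x\<bar> \<le> 2 * C * (1 / (x - a) + 1 / (b - x))" if "a < x" "x < b" for a b n x
  proof -
    have s: "\<bar>p * smooth_step y\<bar> \<le> \<bar>p\<bar>" for p y
      using smooth_step_bounds[of y] by (simp add: abs_mult mult_left_le)
    have "\<bar>deriv (cutoff a b n) x\<bar> \<le> C * (2 / (x - a)) + C * (2 / (b - x))"
      unfolding deriv_cutoff
      using order_trans[OF s scale[of "x - a" n]] order_trans[OF s scale[of "b - x" n]] that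
      by (intro order_trans[OF abs_triangle_ineq4] add_mono) auto
    then show ?thesis by (simp add: field_simps)
  qed
  with C(1) show ?thesis by (intro that[of "2 * C"]) auto
qed

text \<open>Smoothness of \<open>p\<close> inside the interval suffices: near the endpoints and outside, the product is
  zero whatever the values of \<open>p\<close>.\<close>

lemma cutoff_mult_test_function:
  assumes ab: "0 \<le> a" "a < b" "b \<le> R" and p: "\<And>k. smooth_upto k {a<..<b} p"
  shows "(\<lambda>x. cutoff a b (Suc n) x * p x) \<in> test_functions R"
proof -
  let ?\<phi> = "\<lambda>x. cutoff a b (Suc n) x * p x"
  define e where "e = 1 / real (Suc n)"
  have e: "e > 0" by (simp add: e_def)
  have cut: "cutoff a b (Suc n) x = 0" if "x \<le> a + e \<or> x \<ge> b - e" for x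
    using cutoff_eq_0[of x a n b] that by (simp add: e_def)
  then have zero: "?\<phi> x = 0" if "x \<le> a + e \<or> x \<ge> b - e" for x
    using that by simp
  have "smooth_upto k UNIV ?\<phi>" for k
  proof -
    have 1: "smooth_upto k {a<..<b} ?\<phi>"
      by (intro smooth_upto_mult p smooth_upto_subset[OF smooth_upto_cutoff]) auto
    have 2: "smooth_upto k ({..<a + e} \<union> {b - e<..}) ?\<phi>"
      by (rule smooth_upto_cong[of _ _ "\<lambda>x. 0"]) (use cut in \<open>auto simp del: mult_eq_0_iff\<close>)
    show ?thesis
      by (rule smooth_upto_subset[OF smooth_upto_Un[OF 1 2]]) (use e in auto)
  qed
  then have sm: "\<forall>k x. ((deriv ^^ k) ?\<phi>) field_differentiable (at x)"
    unfolding smooth_upto_def by blast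
  have supp: "closure {x. ?\<phi> x \<noteq> 0} \<subseteq> {a + e..b - e}"
  proof (rule closure_minimal)
    show "{x. ?\<phi> x \<noteq> 0} \<subseteq> {a + e..b - e}"
    proof
      fix x assume "x \<in> {x. ?\<phi> x \<noteq> 0}"
      then have "\<not> (x \<le> a + e \<or> x \<ge> b - e)" using zero[of x] by blast
      then show "x \<in> {a + e..b - e}" by auto
    qed
  qed simp
  moreover have "{a + e..b - e} \<subseteq> {0<..<R}" using ab e by auto
  moreover have "compact (closure {x. ?\<phi> x \<noteq> 0})"
    using supp by (meson bounded_closed_interval bounded_subset closed_closure compact_eq_bounded_closed)
  ultimately show ?thesis using sm by (auto simp: test_functions_def)
qed

section \<open>Uniqueness of weak derivatives\<close>

lemma borel_measurable_lebesgue_continuous: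
  fixes f :: "real \<Rightarrow> real"
  assumes "continuous_on UNIV f"
  shows "f \<in> borel_measurable lebesgue"
  using borel_measurable_continuous_onI[OF assms] by (intro measurable_completion) simp

text \<open>Open intervals generate the Borel sets and are closed under intersection, so the integral over every
  Borel set vanishes. Complements are handled by the total integral, which is itself an interval integral
  because of the bounded support.\<close>

lemma AE_eq_0_of_interval_integrals:
  fixes f :: "real \<Rightarrow> real"
  assumes f: "integrable lborel f"
    and int: "\<And>a b. (\<integral>x. indicator {a<..<b} x * f x \<partial>lborel) = 0"
    and supp: "\<And>x. x \<notin> {c<..<d} \<Longrightarrow> f x = 0"
  shows "AE x in lborel. f x = 0"
proof (rule sigma_finite_measure.density_zero[OF sigma_finite_lborel f])
  fix A :: "real set" assume "A \<in> sets lborel"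
  define G where "G = range (\<lambda>(a, b). {a<..<b::real})"
  have "(\<lambda>(a, b). box a b) = (\<lambda>(a, b). {a<..<b::real})" by auto
  then have sets: "sets lborel = sigma_sets UNIV G"
    by (simp add: borel_eq_box G_def)
  have fA: "integrable lborel (\<lambda>x. indicator A x * f x)" if "A \<in> sets lborel" for A
    using integrable_mult_indicator[OF that f] by simp
  have tot: "(\<integral>x. f x \<partial>lborel) = 0"
  proof -
    have "(\<lambda>x. indicator {c<..<d} x * f x) = f"
      using supp by (auto simp: fun_eq_iff indicator_def)
    then show ?thesis using int[of c d] by simp
  qed
  have "(\<integral>x. indicator A x * f x \<partial>lborel) = 0"
  proof (rule sigma_sets_induct_disjoint[of G UNIV A "\<lambda>A. (\<integral>x. indicator A x * f x \<partial>lborel) = 0"])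
    show "Int_stable G"
      unfolding Int_stable_def G_def by (auto simp: Int_greaterThanLessThan)
    show "A \<in> sigma_sets UNIV G" using \<open>A \<in> sets lborel\<close> sets by simp
    show "(\<integral>x. indicator A x * f x \<partial>lborel) = 0" if "A \<in> G" for A
      using that int by (auto simp: G_def)
  next
    fix A assume A: "A \<in> sigma_sets UNIV G" and 0: "(\<integral>x. indicator A x * f x \<partial>lborel) = 0"
    have "(\<integral>x. indicator (UNIV - A) x * f x \<partial>lborel) = (\<integral>x. f x - indicator A x * f x \<partial>lborel)"
      by (intro Bochner_Integration.integral_cong) (auto simp: indicator_def)
    also have "\<dots> = 0"
      using A 0 tot sets by (subst Bochner_Integration.integral_diff[OF f fA]) auto
    finally show "(\<integral>x. indicator (UNIV - A) x * f x \<partial>lborel) = 0" .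
  next
    fix A :: "nat \<Rightarrow> real set"
    assume A: "disjoint_family A" "range A \<subseteq> sigma_sets UNIV G"
      and 0: "\<And>i. (\<integral>x. indicator (A i) x * f x \<partial>lborel) = 0"
    have m: "A i \<in> sets lborel" for i using A(2) sets by auto
    have "set_lebesgue_integral lborel (\<Union>i. A i) f = (\<Sum>i. set_lebesgue_integral lborel (A i) f)"
    proof (rule lebesgue_integral_countable_add)
      show "set_integrable lborel (\<Union>i. A i) f"
        unfolding set_integrable_def using m by (intro integrable_mult_indicator f) auto
    qed (use A m in \<open>auto simp: disjoint_family_on_def\<close>)
    then show "(\<integral>x. indicator (\<Union>i. A i) x * f x \<partial>lborel) = 0"
      using 0 by (simp add: set_lebesgue_integral_def)
  qed auto
  then show "set_lebesgue_integral lborel A f = 0"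
    by (simp add: set_lebesgue_integral_def)
qed

text \<open>The fundamental lemma of the calculus of variations. The cutoffs of an interval are test functions and
  converge boundedly to its indicator, so the integral over every interval is zero. The local statement
  is proved for a Borel representative and transferred back; countably many intervals exhaust \<open>(0,R)\<close>.\<close>

lemma test_functions_separate:
  assumes f: "f \<in> L1_loc R"
    and zero: "\<And>\<phi>. \<phi> \<in> test_functions R \<Longrightarrow> (\<integral>r. f r * \<phi> r \<partial>lebesgue_on {0<..<R}) = 0"
  shows "AE r in lebesgue_on {0<..<R}. f r = 0"
proof -
  have loc: "AE r in lebesgue. r \<in> {a<..<b} \<longrightarrow> f r = 0" if ab: "0 < a" "b < R" for a b
  proof -
    define g where "g = (\<lambda>r. indicator {a<..<b} r * f r)"
    have "integrable (lebesgue_on {a..b}) f"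
      using f ab unfolding L1_loc_def by (smt (verit) atLeastAtMost_iff compact_Icc greaterThanLessThan_iff mem_Collect_eq subsetI)
    then have "integrable lebesgue (\<lambda>r. indicator {a..b} r * f r)"
      by (subst (asm) integrable_restrict_space) auto
    from integrable_mult_indicator[OF _ this, of "{a<..<b}"]
    have g: "integrable lebesgue g"
      by (rule back_subst[where P="integrable lebesgue"]) (auto simp: g_def indicator_def fun_eq_iff)
    then obtain g' where g': "g' \<in> borel_measurable lborel" "AE r in lborel. g r = g' r"
      using completion_ex_borel_measurable_real[of g lborel] by auto
    define h where "h = (\<lambda>r. indicator {a<..<b} r * g' r)"
    have h[measurable]: "h \<in> borel_measurable lborel" unfolding h_def using g'(1) by measurable
    have gh: "AE r in lborel. g r = h r"
      using g'(2) by eventually_elim (auto simp: g_def h_def split: split_indicator)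
    then have gh': "AE r in lebesgue. g r = h r" by (rule AE_completion)
    have h_int: "integrable lborel h"
    proof -
      have "integrable lebesgue h"
        by (rule integrable_cong_AE_imp[OF g measurable_completion[OF h] gh'])
      then show ?thesis using integrable_completion[OF h] by simp
    qed
    have "AE r in lborel. h r = 0"
    proof (rule AE_eq_0_of_interval_integrals[OF h_int])
      show "h r = 0" if "r \<notin> {a<..<b}" for r using that by (simp add: h_def)
      fix p q :: real
      define p' where "p' = max p a"
      define q' where "q' = min q b"
      have "(\<integral>r. indicator {p<..<q} r * h r \<partial>lborel) = (\<integral>r. indicator {p<..<q} r * h r \<partial>lebesgue)"
        by (rule integral_completion[symmetric]) measurable
      also have "\<dots> = (\<integral>r. indicator {p<..<q} r * g r \<partial>lebesgue)"
      proof (rule integral_cong_AE)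
        show "(\<lambda>r. indicator {p<..<q} r * h r) \<in> borel_measurable lebesgue"
          by (intro measurable_completion) measurable
        show "(\<lambda>r. indicator {p<..<q} r * g r) \<in> borel_measurable lebesgue"
          by (intro borel_measurable_times borel_measurable_indicator borel_measurable_integrable[OF g]) auto
      qed (use gh' in auto)
      also have "\<dots> = 0"
      proof (cases "p' < q'")
        case False
        then have "(\<lambda>r. indicator {p<..<q} r * g r) = (\<lambda>r. 0)"
          by (auto simp: fun_eq_iff g_def indicator_def p'_def q'_def)
        then show ?thesis by simp
      next
        case True
        have lim: "(\<lambda>n. \<integral>r. cutoff p' q' (Suc n) r * g r \<partial>lebesgue)
            \<longlonglongrightarrow> (\<integral>r. indicator {p<..<q} r * g r \<partial>lebesgue)"
        proof (rule integral_dominated_convergence[where w="\<lambda>r. \<bar>g r\<bar>"])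
          show "(\<lambda>r. cutoff p' q' (Suc n) r * g r) \<in> borel_measurable lebesgue" for n
          proof (rule borel_measurable_times)
            have "continuous_on UNIV (cutoff p' q' (Suc n))"
              by (intro continuous_at_imp_continuous_on ballI DERIV_isCont[OF cutoff_has_derivative])
            then show "cutoff p' q' (Suc n) \<in> borel_measurable lebesgue"
              by (rule borel_measurable_lebesgue_continuous)
          qed (use g in auto)
          show "(\<lambda>r. indicator {p<..<q} r * g r) \<in> borel_measurable lebesgue"
            by (intro borel_measurable_times borel_measurable_indicator borel_measurable_integrable[OF g]) auto
          show "integrable lebesgue (\<lambda>r. \<bar>g r\<bar>)" using g by simp
          show "AE r in lebesgue. norm (cutoff p' q' (Suc n) r * g r) \<le> \<bar>g r\<bar>" for n
            using cutoff_bounds[of p' q' "Suc n"] by (auto simp: abs_mult mult_left_le_one_le)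
          show "AE r in lebesgue. (\<lambda>n. cutoff p' q' (Suc n) r * g r) \<longlonglongrightarrow> indicator {p<..<q} r * g r"
          proof (rule AE_I2)
            fix r
            show "(\<lambda>n. cutoff p' q' (Suc n) r * g r) \<longlonglongrightarrow> indicator {p<..<q} r * g r"
            proof (cases "p' < r \<and> r < q'")
              case True
              have "\<forall>\<^sub>F n in sequentially. cutoff p' q' (Suc n) r = 1"
                using cutoff_eventually_1[of p' r q'] True by (auto elim: eventually_mono)
              then have "\<forall>\<^sub>F n in sequentially. cutoff p' q' (Suc n) r * g r = indicator {p<..<q} r * g r"
                by eventually_elim (use True in \<open>auto simp: p'_def q'_def\<close>)
              then show ?thesis by (rule tendsto_eventually)
            next
              case False
              then have "cutoff p' q' (Suc n) r = 0" for n by (rule cutoff_eq_0_outside)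
              moreover have "indicator {p<..<q} r * g r = 0"
                using False by (auto simp: g_def indicator_def p'_def q'_def)
              ultimately show ?thesis by (simp only: mult_zero_left tendsto_const)
            qed
          qed
        qed
        have "(\<integral>r. cutoff p' q' (Suc n) r * g r \<partial>lebesgue) = 0" for n
        proof -
          have "0 \<le> p'" "q' \<le> R" using ab by (auto simp: p'_def q'_def)
          from cutoff_mult_test_function[OF this(1) True this(2), of "\<lambda>_. 1" n]
          have "cutoff p' q' (Suc n) \<in> test_functions R" by simp
          from zero[OF this]
          have "0 = (\<integral>r. indicator {0<..<R} r * (f r * cutoff p' q' (Suc n) r) \<partial>lebesgue)"
            by (subst (asm) integral_restrict_space) auto
          also have "\<dots> = (\<integral>r. cutoff p' q' (Suc n) r * g r \<partial>lebesgue)"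
          proof (rule Bochner_Integration.integral_cong)
            fix r
            show "indicator {0<..<R} r * (f r * cutoff p' q' (Suc n) r) = cutoff p' q' (Suc n) r * g r"
            proof (cases "p' < r \<and> r < q'")
              case True
              then show ?thesis using ab by (auto simp: g_def p'_def q'_def)
            next
              case False
              then have "cutoff p' q' (Suc n) r = 0" by (rule cutoff_eq_0_outside)
              then show ?thesis by simp
            qed
          qed simp
          finally show ?thesis by simp
        qed
        then show ?thesis using LIMSEQ_unique[OF lim] by simp
      qed
      finally show "(\<integral>r. indicator {p<..<q} r * h r \<partial>lborel) = 0" .
    qed
    then have "AE r in lebesgue. h r = 0" by (rule AE_completion)
    with gh' show ?thesis by eventually_elim (auto simp: g_def)
  qed
  have "AE r in lebesgue. \<forall>n::nat. r \<in> {1 / Suc n<..<R - 1 / Suc n} \<longrightarrow> f r = 0"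
    unfolding AE_all_countable by (intro allI loc) auto
  then have "AE r in lebesgue. r \<in> {0<..<R} \<longrightarrow> f r = 0"
  proof eventually_elim
    case (elim r)
    show ?case
    proof
      assume r: "r \<in> {0<..<R}"
      then obtain n :: nat where "1 / Suc n < min r (R - r)"
        using reals_Archimedean[of "min r (R - r)"] by (auto simp: inverse_eq_divide)
      then have "r \<in> {1 / Suc n<..<R - 1 / Suc n}" by auto
      with elim show "f r = 0" by blast
    qed
  qed
  then show ?thesis by (subst AE_restrict_space_iff) auto
qed

lemma test_function_continuous:
  assumes "\<phi> \<in> test_functions R"
  shows "(\<phi> has_real_derivative deriv \<phi> x) (at x)" "continuous_on A \<phi>" "continuous_on A (deriv \<phi>)"
proof -
  have d: "((deriv ^^ k) \<phi>) field_differentiable (at x)" for k x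
    using assms by (auto simp: test_functions_def)
  show "(\<phi> has_real_derivative deriv \<phi> x) (at x)"
    using d[of 0 x] field_differentiable_derivI by auto
  show "continuous_on A \<phi>"
    using d[of 0] by (auto intro!: continuous_at_imp_continuous_on field_differentiable_imp_continuous_at)
  show "continuous_on A (deriv \<phi>)"
    using d[of 1] by (auto intro!: continuous_at_imp_continuous_on field_differentiable_imp_continuous_at)
qed

text \<open>The endpoints are chosen strictly outside the support, so that the function vanishes at both of them.\<close>

lemma test_function_support:
  assumes "\<phi> \<in> test_functions R"
  obtains a b where "0 < a" "a < b" "b < R" "\<And>x. x \<notin> {a<..<b} \<Longrightarrow> \<phi> x = 0" | "\<phi> = (\<lambda>_. 0)"
proof (cases "{x. \<phi> x \<noteq> 0} = {}")
  case True
  then show ?thesis using that(2) by auto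
next
  case False
  define S where "S = closure {x. \<phi> x \<noteq> 0}"
  have S: "compact S" "S \<subseteq> {0<..<R}" "S \<noteq> {}" "{x. \<phi> x \<noteq> 0} \<subseteq> S"
    using assms False closure_subset[of "{x. \<phi> x \<noteq> 0}"] by (auto simp: test_functions_def S_def)
  obtain p where p: "p \<in> S" "\<And>x. x \<in> S \<Longrightarrow> p \<le> x" using compact_attains_inf[OF S(1,3)] by auto
  obtain q where q: "q \<in> S" "\<And>x. x \<in> S \<Longrightarrow> x \<le> q" using compact_attains_sup[OF S(1,3)] by auto
  have "0 < p" "q < R" using p q S by auto
  moreover have "p \<le> q" using p q by auto
  ultimately show ?thesis
  proof (intro that(1)[of "p / 2" "(q + R) / 2"])
    fix x assume x: "x \<notin> {p / 2<..<(q + R) / 2}"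
    show "\<phi> x = 0"
    proof (rule ccontr)
      assume "\<phi> x \<noteq> 0"
      then have "x \<in> S" using S(4) by auto
      then have "p \<le> x" "x \<le> q" using p q by auto
      then show False using x \<open>0 < p\<close> \<open>q < R\<close> by auto
    qed
  qed auto
qed

lemma L1_loc_mult_continuous:
  assumes h: "h \<in> L1_loc R" and \<phi>: "continuous_on UNIV \<phi>"
    and ab: "0 < a" "b < R" "\<And>x. x \<notin> {a..b} \<Longrightarrow> \<phi> x = 0"
  shows "integrable (lebesgue_on {0<..<R}) (\<lambda>r. h r * \<phi> r)"
proof -
  have "compact (\<phi> ` {a..b})" by (intro compact_continuous_image continuous_on_subset[OF \<phi>]) auto
  then obtain C where C: "\<And>x. x \<in> {a..b} \<Longrightarrow> \<bar>\<phi> x\<bar> \<le> C"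
    unfolding real_norm_def[symmetric] by (metis bounded_iff compact_imp_bounded image_eqI)
  have "integrable (lebesgue_on {a..b}) h" using h ab unfolding L1_loc_def
    by (smt (verit) atLeastAtMost_iff compact_Icc greaterThanLessThan_iff mem_Collect_eq subsetI)
  then have i: "integrable lebesgue (\<lambda>r. indicator {a..b} r * h r)"
    by (subst (asm) integrable_restrict_space) auto
  have "\<phi> \<in> borel_measurable lebesgue"
    by (rule borel_measurable_lebesgue_continuous[OF \<phi>])
  then have "integrable lebesgue (\<lambda>r. (indicator {a..b} r * h r) * \<phi> r)"
    using C
    by (intro Bochner_Integration.integrable_bound[OF integrable_mult_right[OF i, of "C"]])
       (use borel_measurable_integrable[OF i] in \<open>auto simp: indicator_def abs_mult intro!: AE_I2,
          metis abs_ge_zero abs_ge_self mult.commute mult_right_mono order_trans\<close>)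
  moreover have "(\<lambda>r. (indicator {a..b} r * h r) * \<phi> r) = (\<lambda>r. indicator {0<..<R} r * (h r * \<phi> r))"
    using ab by (auto simp: fun_eq_iff indicator_def)
  ultimately show ?thesis
    by (subst integrable_restrict_space) auto
qed

lemma L1_loc_mult_test_function:
  assumes h: "h \<in> L1_loc R" and \<phi>: "\<phi> \<in> test_functions R"
  shows "integrable (lebesgue_on {0<..<R}) (\<lambda>r. h r * \<phi> r)"
  using \<phi>
proof (cases rule: test_function_support)
  case (1 a b)
  then show ?thesis
    by (intro L1_loc_mult_continuous[OF h _ 1(1,3)] test_function_continuous[OF \<phi>]) auto
qed auto

lemma deriv_test_function_eq_0:
  assumes "\<And>x. x \<notin> {a<..<b} \<Longrightarrow> \<phi> x = 0" and x: "x \<notin> {a..b}"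
  shows "deriv \<phi> x = (0::real)"
proof -
  have "\<forall>\<^sub>F y in nhds x. \<phi> y = 0"
  proof (rule eventually_mono[OF eventually_nhds_in_open[of "- {a..b}" x]])
    fix y assume "y \<in> - {a..b}"
    then show "\<phi> y = 0" by (intro assms(1)) auto
  qed (use x in auto)
  then have "deriv \<phi> x = deriv (\<lambda>_. 0) x" by (intro deriv_cong_ev) auto
  then show ?thesis by simp
qed

lemma L1_loc_mult_deriv_test_function:
  assumes h: "h \<in> L1_loc R" and \<phi>: "\<phi> \<in> test_functions R"
  shows "integrable (lebesgue_on {0<..<R}) (\<lambda>r. h r * deriv \<phi> r)"
  using \<phi>
proof (cases rule: test_function_support)
  case (1 a b)
  from deriv_test_function_eq_0[OF 1(4)] show ?thesis
    by (intro L1_loc_mult_continuous[OF h _ 1(1,3)] test_function_continuous[OF \<phi>]) auto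
qed auto

lemma has_weak_derivative_unique:
  assumes "has_weak_derivative R v d" "has_weak_derivative R v e"
  shows "AE r in lebesgue_on {0<..<R}. d r = e r"
proof -
  let ?M = "lebesgue_on {0<..<R}"
  have d: "d \<in> L1_loc R" "e \<in> L1_loc R" using assms by (auto simp: has_weak_derivative_def)
  have "AE r in ?M. d r - e r = 0"
  proof (rule test_functions_separate)
    show "(\<lambda>r. d r - e r) \<in> L1_loc R" using d by (auto simp: L1_loc_def)
    fix \<phi> assume \<phi>: "\<phi> \<in> test_functions R"
    have "(\<integral>r. d r * \<phi> r \<partial>?M) = (\<integral>r. e r * \<phi> r \<partial>?M)"
      using assms \<phi> by (auto simp: has_weak_derivative_def)
    moreover have "integrable ?M (\<lambda>r. h r * \<phi> r)" if "h \<in> L1_loc R" for h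
      by (rule L1_loc_mult_test_function[OF that \<phi>])
    ultimately show "(\<integral>r. (d r - e r) * \<phi> r \<partial>?M) = 0"
      using d by (simp add: left_diff_distrib)
  qed
  then show ?thesis by eventually_elim simp
qed

section \<open>Iterated primitives of the weight and their monotonicity\<close>

lemma continuous_on_weight:
  assumes "p > 0"
  shows "continuous_on {0..} (weight p)"
  unfolding weight_def[abs_def] using assms
  by (intro continuous_on_mult continuous_on_powr' continuous_intros) auto

lemma weight_pos: "r > 0 \<Longrightarrow> weight p r > 0"
  by (simp add: weight_def)

lemma weight_nonneg: "weight p r \<ge> 0"
  by (simp add: weight_def)

lemma weight_0 [simp]: "weight p 0 = 0"
  by (simp add: weight_def)

lemma weight_add_1: "r \<ge> 0 \<Longrightarrow> weight (p + 1) r = r * weight p r"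
  by (cases "r = 0") (auto simp: weight_def powr_add)

lemma weight_has_derivative:
  assumes "r > 0"
  shows "(weight p has_real_derivative (p / r - r) * weight p r) (at r)"
proof -
  have "((\<lambda>r. r powr p) has_real_derivative p * r powr (p - 1)) (at r)"
    by (rule has_real_derivative_powr[OF assms])
  moreover have "((\<lambda>r. exp (- r\<^sup>2 / 2)) has_real_derivative - r * exp (- r\<^sup>2 / 2)) (at r)"
    by (auto intro!: derivative_eq_intros)
  ultimately have "((\<lambda>r. r powr p * exp (- r\<^sup>2 / 2)) has_real_derivative
      p * r powr (p - 1) * exp (- r\<^sup>2 / 2) + - r * exp (- r\<^sup>2 / 2) * r powr p) (at r)"
    by (rule DERIV_mult)
  moreover have "p * r powr (p - 1) * exp (- r\<^sup>2 / 2) + - r * exp (- r\<^sup>2 / 2) * r powr p = (p / r - r) * weight p r"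
    using assms by (simp add: weight_def powr_diff algebra_simps)
  ultimately show ?thesis unfolding weight_def[abs_def] by simp
qed

definition cum_w :: "real \<Rightarrow> real \<Rightarrow> real" where
  "cum_w p r = integral {0..r} (weight p)"

text \<open>The primitive of \<open>w(s)/s\<close>. This integrand is discontinuous at \<open>0\<close> when \<open>m = 1\<close>; the
  definition uses the identity \<open>m w(s)/s = w'(s) + s w(s)\<close> instead, in which only continuous
  integrands occur.\<close>

definition cum_w_div :: "real \<Rightarrow> real \<Rightarrow> real" where
  "cum_w_div m r = (weight m r + cum_w (m + 1) r) / m"

text \<open>The primitives of \<open>cum_w m\<close> and of \<open>cum_w_div m\<close>, both vanishing at \<open>0\<close>, in the form given by
  integration by parts.\<close>

definition cum2_w :: "real \<Rightarrow> real \<Rightarrow> real" where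
  "cum2_w m r = r * cum_w m r - cum_w (m + 1) r"

definition cum2_w_div :: "real \<Rightarrow> real \<Rightarrow> real" where
  "cum2_w_div m r = r * cum_w_div m r - cum_w m r"

lemma weight_integrable:
  assumes "p > 0" "0 \<le> a" shows "weight p integrable_on {a..b}"
  by (rule integrable_continuous_real)
     (use assms in \<open>auto intro: continuous_on_subset[OF continuous_on_weight[OF assms(1)]]\<close>)

lemma continuous_on_atLeast_0I:
  fixes f :: "real \<Rightarrow> real"
  assumes "\<And>b. continuous_on {0..b} f"
  shows "continuous_on {0..} f"
proof -
  have "continuous (at x within {0..}) f" if "x \<ge> 0" for x
  proof -
    have "continuous (at x within {0..x + 1}) f"
      using assms[of "x + 1"] that by (auto simp: continuous_on_eq_continuous_within)
    moreover have "at x within {0..} = at x within {0..x + 1}"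
    proof (rule at_within_nhd[of x "{..<x + 1}"])
      show "{0..} \<inter> {..<x + 1} - {x} = {0..x + 1} \<inter> {..<x + 1} - {x}" by auto
    qed auto
    ultimately show ?thesis by simp
  qed
  then show ?thesis by (auto simp: continuous_on_eq_continuous_within)
qed

lemma continuous_on_cum_w: "p > 0 \<Longrightarrow> continuous_on {0..} (cum_w p)"
  unfolding cum_w_def[abs_def]
  by (intro continuous_on_atLeast_0I indefinite_integral_continuous_1 weight_integrable) auto

lemma cum_w_0 [simp]: "cum_w p 0 = 0"
  by (simp add: cum_w_def)

lemma cum_w_has_derivative:
  assumes "p > 0" "r > 0"
  shows "(cum_w p has_real_derivative weight p r) (at r)"
proof -
  have "continuous_on {0..r + 1} (weight p)"
    by (rule continuous_on_subset[OF continuous_on_weight[OF assms(1)]]) auto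
  from integral_has_real_derivative[OF this, of r] assms
  have "(cum_w p has_real_derivative weight p r) (at r within {0..r + 1})"
    by (simp add: cum_w_def[abs_def])
  then show ?thesis using assms by (subst (asm) at_within_Icc_at) auto
qed

lemma pos_if_derivative_pos:
  fixes f :: "real \<Rightarrow> real"
  assumes "continuous_on {0..} f" "f 0 = 0" "r > 0"
    and "\<And>s. s > 0 \<Longrightarrow> (f has_real_derivative f' s) (at s)" "\<And>s. s > 0 \<Longrightarrow> f' s > 0"
  shows "f r > 0"
proof -
  have "f 0 < f r"
    by (rule DERIV_pos_imp_increasing_open[OF assms(3)])
       (use assms in \<open>auto intro: continuous_on_subset[OF assms(1)]\<close>)
  then show ?thesis using assms(2) by simp
qed

lemma nonneg_if_derivative_nonneg:
  fixes f :: "real \<Rightarrow> real"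
  assumes "continuous_on {0..} f" "f 0 = 0" "r > 0"
    and "\<And>s. s > 0 \<Longrightarrow> (f has_real_derivative f' s) (at s)" "\<And>s. s > 0 \<Longrightarrow> f' s \<ge> 0"
  shows "f r \<ge> 0"
proof -
  have "continuous_on {0..r} f" by (rule continuous_on_subset[OF assms(1)]) auto
  obtain z where "0 < z" "z < r" "f r - f 0 = (r - 0) * f' z"
    using MVT[OF assms(3) \<open>continuous_on {0..r} f\<close>] assms(4) DERIV_unique
    by (metis real_differentiable_def)
  then show ?thesis using assms(2,3) assms(5)[of z] by simp
qed

text \<open>The flux \<open>w (v' - h)\<close> of the solution with parameters \<open>c\<close> and \<open>b\<close> is
  \<open>c \<alpha> + b \<beta>\<close>, where \<open>\<alpha>\<close> and \<open>\<beta>\<close> are the next two functions.\<close>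

definition flux_alpha :: "real \<Rightarrow> real \<Rightarrow> real" where
  "flux_alpha m r = cum2_w m r + r * cum2_w_div m r"

definition flux_beta :: "real \<Rightarrow> real \<Rightarrow> real" where
  "flux_beta m r = r * cum2_w m r + m * cum2_w_div m r"

definition sq_diff :: "real \<Rightarrow> real \<Rightarrow> real" where
  "sq_diff m r = m * (cum2_w_div m r)\<^sup>2 - (cum2_w m r)\<^sup>2"

definition sq_sum :: "real \<Rightarrow> real \<Rightarrow> real" where
  "sq_sum m r = m * (cum2_w_div m r)\<^sup>2 + (cum2_w m r)\<^sup>2"

text \<open>The reciprocal of the multiplier \<open>c\<close> for the radius \<open>r\<close>, hence of \<open>1 - \<lambda>\<^sub>m(r)\<close>.\<close>

definition inv_gap :: "real \<Rightarrow> real \<Rightarrow> real" where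
  "inv_gap m r = 1 + sq_diff m r / (cum_w m r * flux_beta m r)"

text \<open>For \<open>c = 1\<close> the solution on \<open>(0,r)\<close> satisfies \<open>h(r) = K/\<beta>\<close> and \<open>v(r) = -I/\<beta>\<close>, so this
  is the boundary value of \<open>v\<^sup>2 + m h\<^sup>2\<close>.\<close>

definition bdry_energy :: "real \<Rightarrow> real \<Rightarrow> real" where
  "bdry_energy m r = sq_sum m r / (flux_beta m r)\<^sup>2"

text \<open>Up to the factor \<open>- w / W\<^sup>2\<close> this is the derivative of \<open>inv_gap\<close>.\<close>

definition mono_defect :: "real \<Rightarrow> real \<Rightarrow> real" where
  "mono_defect m r = sq_diff m r / flux_beta m r - cum_w m r * bdry_energy m r"

context
  fixes m :: real
  assumes m: "m \<ge> 1"
begin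

lemma cum_w_div_has_derivative:
  assumes r: "r > 0"
  shows "(cum_w_div m has_real_derivative weight m r / r) (at r)"
proof -
  have "((\<lambda>r. (weight m r + cum_w (m + 1) r) / m) has_real_derivative
      ((m / r - r) * weight m r + weight (m + 1) r) / m) (at r)"
    using m r by (intro DERIV_cdivide DERIV_add weight_has_derivative cum_w_has_derivative) auto
  moreover have "((m / r - r) * weight m r + weight (m + 1) r) / m = weight m r / r"
    using m r weight_add_1[of r m] by (simp add: field_simps)
  ultimately show ?thesis unfolding cum_w_div_def[abs_def] by simp
qed

lemma cum2_w_has_derivative:
  assumes r: "r > 0"
  shows "(cum2_w m has_real_derivative cum_w m r) (at r)"
proof -
  have "((\<lambda>r. r * cum_w m r - cum_w (m + 1) r) has_real_derivative
      (1 * cum_w m r + weight m r * r) - weight (m + 1) r) (at r)"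
    using m r by (intro DERIV_diff DERIV_mult DERIV_ident cum_w_has_derivative) auto
  then show ?thesis using r unfolding cum2_w_def[abs_def] by (simp add: weight_add_1 mult.commute)
qed

lemma cum2_w_div_has_derivative:
  assumes r: "r > 0"
  shows "(cum2_w_div m has_real_derivative cum_w_div m r) (at r)"
proof -
  have "((\<lambda>r. r * cum_w_div m r - cum_w m r) has_real_derivative
      (1 * cum_w_div m r + weight m r / r * r) - weight m r) (at r)"
    using m r by (intro DERIV_diff DERIV_mult DERIV_ident cum_w_has_derivative cum_w_div_has_derivative) auto
  then show ?thesis using r unfolding cum2_w_div_def[abs_def] by simp
qed

lemma continuous_on_cum_w_div: "continuous_on {0..} (cum_w_div m)"
  unfolding cum_w_div_def[abs_def] using m
  by (intro continuous_intros continuous_on_weight continuous_on_cum_w) auto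

lemma continuous_on_cum2_w: "continuous_on {0..} (cum2_w m)"
  unfolding cum2_w_def[abs_def] using m
  by (intro continuous_intros continuous_on_cum_w) auto

lemma continuous_on_cum2_w_div: "continuous_on {0..} (cum2_w_div m)"
  unfolding cum2_w_div_def[abs_def] using m
  by (intro continuous_intros continuous_on_cum_w continuous_on_cum_w_div) auto

lemma primitives_at_0 [simp]: "cum_w_div m 0 = 0" "cum2_w m 0 = 0" "cum2_w_div m 0 = 0"
  by (auto simp: cum_w_div_def cum2_w_def cum2_w_div_def)

lemma cum_w_pos: "r > 0 \<Longrightarrow> cum_w m r > 0"
  using m by (intro pos_if_derivative_pos[OF continuous_on_cum_w _ _ cum_w_has_derivative]) (auto simp: weight_pos)

lemma cum_w_div_pos: "r > 0 \<Longrightarrow> cum_w_div m r > 0"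
  by (intro pos_if_derivative_pos[OF continuous_on_cum_w_div _ _ cum_w_div_has_derivative]) (auto simp: weight_pos)

lemma cum2_w_pos: "r > 0 \<Longrightarrow> cum2_w m r > 0"
  by (intro pos_if_derivative_pos[OF continuous_on_cum2_w _ _ cum2_w_has_derivative]) (auto simp: cum_w_pos)

lemma cum2_w_div_pos: "r > 0 \<Longrightarrow> cum2_w_div m r > 0"
  by (intro pos_if_derivative_pos[OF continuous_on_cum2_w_div _ _ cum2_w_div_has_derivative]) (auto simp: cum_w_div_pos)

lemma cum2_w_le_mult_cum2_w_div:
  assumes "r > 0" shows "cum2_w m r \<le> r * cum2_w_div m r"
proof -
  have "r * cum2_w_div m r - cum2_w m r \<ge> 0"
  proof (rule nonneg_if_derivative_nonneg[where f="\<lambda>r. r * cum2_w_div m r - cum2_w m r" and f'="\<lambda>r. 2 * cum2_w_div m r"])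
    show "continuous_on {0..} (\<lambda>r. r * cum2_w_div m r - cum2_w m r)"
      by (intro continuous_intros continuous_on_cum2_w continuous_on_cum2_w_div)
    fix s :: real assume s: "s > 0"
    have "((\<lambda>r. r * cum2_w_div m r - cum2_w m r) has_real_derivative
        (1 * cum2_w_div m s + cum_w_div m s * s) - cum_w m s) (at s)"
      using s by (intro DERIV_diff DERIV_mult DERIV_ident cum2_w_div_has_derivative cum2_w_has_derivative)
    then show "((\<lambda>r. r * cum2_w_div m r - cum2_w m r) has_real_derivative 2 * cum2_w_div m s) (at s)"
      by (simp add: cum2_w_div_def mult.commute)
    show "2 * cum2_w_div m s \<ge> 0" using cum2_w_div_pos[OF s] by simp
  qed (use assms in auto)
  then show ?thesis by simp
qed

text \<open>The ratio \<open>I/K\<close> is nondecreasing because the ratio \<open>W/F\<close> of the derivatives is; the inequality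
  is the sign of the derivative of \<open>I/K\<close>, with the denominators cleared.\<close>

lemma cum2_w_cum2_w_div_ratio_mono:
  assumes "r > 0" shows "cum2_w m r * cum_w_div m r \<le> cum2_w_div m r * cum_w m r"
proof -
  have "cum2_w_div m r * cum_w m r - cum2_w m r * cum_w_div m r \<ge> 0"
  proof (rule nonneg_if_derivative_nonneg[where f="\<lambda>r. cum2_w_div m r * cum_w m r - cum2_w m r * cum_w_div m r"
          and f'="\<lambda>r. weight m r / r * (r * cum2_w_div m r - cum2_w m r)"])
    show "continuous_on {0..} (\<lambda>r. cum2_w_div m r * cum_w m r - cum2_w m r * cum_w_div m r)"
      using m by (intro continuous_intros continuous_on_cum2_w continuous_on_cum2_w_div continuous_on_cum_w_div continuous_on_cum_w) auto
    fix s :: real assume s: "s > 0"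
    have "((\<lambda>r. cum2_w_div m r * cum_w m r - cum2_w m r * cum_w_div m r) has_real_derivative
        (cum_w_div m s * cum_w m s + weight m s * cum2_w_div m s) - (cum_w m s * cum_w_div m s + weight m s / s * cum2_w m s)) (at s)"
      using s m by (intro DERIV_diff DERIV_mult cum2_w_div_has_derivative cum2_w_has_derivative cum_w_div_has_derivative
          cum_w_has_derivative) auto
    moreover have "(cum_w_div m s * cum_w m s + weight m s * cum2_w_div m s) - (cum_w m s * cum_w_div m s + weight m s / s * cum2_w m s)
       = weight m s / s * (s * cum2_w_div m s - cum2_w m s)"
      using s by (simp add: field_simps)
    ultimately show "((\<lambda>r. cum2_w_div m r * cum_w m r - cum2_w m r * cum_w_div m r) has_real_derivative
       weight m s / s * (s * cum2_w_div m s - cum2_w m s)) (at s)" by simp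
    show "weight m s / s * (s * cum2_w_div m s - cum2_w m s) \<ge> 0" using cum2_w_le_mult_cum2_w_div[OF s] s weight_pos[OF s, of m] by simp
  qed (use assms in auto)
  then show ?thesis by simp
qed

section \<open>Monotone dependence on the radius\<close>

lemma flux_beta_pos: "r > 0 \<Longrightarrow> flux_beta m r > 0"
  using m cum2_w_pos[of r] cum2_w_div_pos[of r] by (simp add: flux_beta_def add_pos_pos)

lemma flux_beta_has_derivative:
  assumes r: "r > 0"
  shows "(flux_beta m has_real_derivative cum2_w m r + r * cum_w m r + m * cum_w_div m r) (at r)"
proof -
  have "((\<lambda>r. r * cum2_w m r + m * cum2_w_div m r) has_real_derivative
      (1 * cum2_w m r + cum_w m r * r) + m * cum_w_div m r) (at r)"
    using r by (intro DERIV_add DERIV_mult DERIV_ident DERIV_cmult cum2_w_div_has_derivative cum2_w_has_derivative)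
  then show ?thesis unfolding flux_beta_def[abs_def] by (simp add: ac_simps)
qed

lemma sq_diff_has_derivative:
  assumes r: "r > 0"
  shows "(sq_diff m has_real_derivative 2 * (m * cum2_w_div m r * cum_w_div m r - cum2_w m r * cum_w m r)) (at r)"
proof -
  have "((\<lambda>r. m * (cum2_w_div m r * cum2_w_div m r) - cum2_w m r * cum2_w m r) has_real_derivative
      m * (cum_w_div m r * cum2_w_div m r + cum_w_div m r * cum2_w_div m r) - (cum_w m r * cum2_w m r + cum_w m r * cum2_w m r)) (at r)"
    using r by (intro DERIV_diff DERIV_mult DERIV_cmult cum2_w_div_has_derivative cum2_w_has_derivative)
  then show ?thesis unfolding sq_diff_def[abs_def] power2_eq_square by (simp add: algebra_simps)
qed

lemma sq_sum_has_derivative: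
  assumes r: "r > 0"
  shows "(sq_sum m has_real_derivative 2 * (m * cum2_w_div m r * cum_w_div m r + cum2_w m r * cum_w m r)) (at r)"
proof -
  have "((\<lambda>r. m * (cum2_w_div m r * cum2_w_div m r) + cum2_w m r * cum2_w m r) has_real_derivative
      m * (cum_w_div m r * cum2_w_div m r + cum_w_div m r * cum2_w_div m r) + (cum_w m r * cum2_w m r + cum_w m r * cum2_w m r)) (at r)"
    using r by (intro DERIV_add DERIV_mult DERIV_cmult cum2_w_div_has_derivative cum2_w_has_derivative)
  then show ?thesis unfolding sq_sum_def[abs_def] power2_eq_square by (simp add: algebra_simps)
qed

text \<open>With the definition of \<open>K\<close>, this eliminates \<open>w\<close> from the algebraic identities below.\<close>

lemma weight_eq: "weight m r = m * cum_w_div m r - r * cum_w m r + cum2_w m r"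
  using m by (simp add: cum_w_div_def cum2_w_def)

text \<open>Hadamard's formula in disguise: for \<open>c = 1\<close>, \<open>(m K\<^sup>2 - I\<^sup>2)/\<beta>\<close> plus \<open>W\<close> is the stationary value
  of the problem with a linear term in \<open>g\<close> in place of the constraint, and such a value changes with the
  domain at the rate of the Lagrangian at the endpoint.\<close>

lemma sq_diff_flux_beta_has_derivative:
  assumes r: "r > 0"
  shows "((\<lambda>r. sq_diff m r / flux_beta m r) has_real_derivative weight m r * sq_sum m r / (flux_beta m r)\<^sup>2) (at r)"
proof -
  have num: "2 * (m * cum2_w_div m r * cum_w_div m r - cum2_w m r * cum_w m r) * flux_beta m r
      - sq_diff m r * (cum2_w m r + r * cum_w m r + m * cum_w_div m r) = weight m r * sq_sum m r"
    unfolding weight_eq flux_beta_def sq_diff_def sq_sum_def using cum2_w_div_def[of m r] by algebra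
  show ?thesis
    using DERIV_divide[OF sq_diff_has_derivative[OF r] flux_beta_has_derivative[OF r]] flux_beta_pos[OF r] num
    by (simp add: power2_eq_square)
qed

text \<open>With \<open>t = I/K\<close> the boundary energy is \<open>(m + t\<^sup>2)/(m + r t)\<^sup>2\<close>. It is nonincreasing in \<open>r\<close>
  since \<open>t\<close> is nondecreasing and \<open>t \<le> r\<close>; these two facts give the signs of the two factors in the
  numerator that the proof isolates.\<close>

lemma bdry_energy_has_derivative:
  assumes r: "r > 0"
  obtains D where "(bdry_energy m has_real_derivative D) (at r)" "D \<le> 0"
proof -
  let ?b' = "cum2_w m r + r * cum_w m r + m * cum_w_div m r"
  let ?q' = "2 * (m * cum2_w_div m r * cum_w_div m r + cum2_w m r * cum_w m r)"
  have b2: "((\<lambda>r. (flux_beta m r)\<^sup>2) has_real_derivative 2 * flux_beta m r * ?b') (at r)"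
    using DERIV_mult[OF flux_beta_has_derivative[OF r] flux_beta_has_derivative[OF r]]
    unfolding power2_eq_square by (simp add: algebra_simps)
  have D: "(bdry_energy m has_real_derivative (?q' * (flux_beta m r)\<^sup>2 - sq_sum m r * (2 * flux_beta m r * ?b')) / ((flux_beta m r)\<^sup>2 * (flux_beta m r)\<^sup>2)) (at r)"
    unfolding bdry_energy_def[abs_def] using DERIV_divide[OF sq_sum_has_derivative[OF r] b2] flux_beta_pos[OF r] by simp
  have "?q' * flux_beta m r - sq_sum m r * (2 * ?b')
      = 2 * (- (m * (r * cum2_w_div m r - cum2_w m r) * (cum2_w_div m r * cum_w m r - cum2_w m r * cum_w_div m r)) - cum2_w m r * sq_sum m r)"
    unfolding flux_beta_def sq_sum_def by algebra
  also have "\<dots> \<le> 0"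
  proof -
    have "m * (r * cum2_w_div m r - cum2_w m r) * (cum2_w_div m r * cum_w m r - cum2_w m r * cum_w_div m r) \<ge> 0"
      using m cum2_w_le_mult_cum2_w_div[OF r] cum2_w_cum2_w_div_ratio_mono[OF r] by simp
    moreover have "cum2_w m r * sq_sum m r \<ge> 0" using cum2_w_pos[OF r] m by (simp add: sq_sum_def)
    moreover have "2 * (- A - B) \<le> 0" if "A \<ge> 0" "B \<ge> 0" for A B :: real using that by simp
    ultimately show ?thesis by blast
  qed
  finally have "(?q' * flux_beta m r - sq_sum m r * (2 * ?b')) * flux_beta m r \<le> 0"
    using flux_beta_pos[OF r] by (simp add: mult_nonpos_nonneg)
  then have "?q' * (flux_beta m r)\<^sup>2 - sq_sum m r * (2 * flux_beta m r * ?b') \<le> 0"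
    by (simp add: power2_eq_square algebra_simps)
  with D show ?thesis by (intro that[OF D]) (simp add: divide_nonpos_nonneg)
qed

text \<open>In the derivative the two terms with \<open>w\<close> cancel, and \<open>- W\<close> times the derivative of the
  boundary energy remains.\<close>

lemma mono_defect_mono:
  assumes "0 < r" "r \<le> s" shows "mono_defect m r \<le> mono_defect m s"
proof (rule DERIV_nonneg_imp_nondecreasing[OF assms(2)])
  fix x assume "r \<le> x" "x \<le> s"
  with assms have x: "x > 0" by simp
  obtain D where D: "(bdry_energy m has_real_derivative D) (at x)" "D \<le> 0" using bdry_energy_has_derivative[OF x] .
  have "(mono_defect m has_real_derivative weight m x * sq_sum m x / (flux_beta m x)\<^sup>2 - (weight m x * bdry_energy m x + D * cum_w m x)) (at x)"
    unfolding mono_defect_def[abs_def] using m x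
    by (intro DERIV_diff sq_diff_flux_beta_has_derivative DERIV_mult D cum_w_has_derivative) auto
  moreover have "weight m x * sq_sum m x / (flux_beta m x)\<^sup>2 - (weight m x * bdry_energy m x + D * cum_w m x) = - D * cum_w m x"
    by (simp add: bdry_energy_def)
  moreover have "- D * cum_w m x \<ge> 0" using D cum_w_pos[OF x] by (intro mult_nonneg_nonneg) auto
  ultimately show "\<exists>y. (mono_defect m has_real_derivative y) (at x) \<and> 0 \<le> y" by auto
qed

lemma bdry_energy_le:
  assumes r: "r > 0" shows "bdry_energy m r \<le> 1 / m + r\<^sup>2 / m\<^sup>2"
proof -
  have b: "flux_beta m r \<ge> m * cum2_w_div m r" using r cum2_w_pos[OF r] by (simp add: flux_beta_def)
  have "sq_sum m r \<le> m * (cum2_w_div m r)\<^sup>2 + (r * cum2_w_div m r)\<^sup>2"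
    unfolding sq_sum_def using cum2_w_le_mult_cum2_w_div[OF r] cum2_w_pos[OF r] by (intro add_left_mono power_mono) auto
  also have "\<dots> = (1 / m + r\<^sup>2 / m\<^sup>2) * (m * cum2_w_div m r)\<^sup>2"
    using m by (simp add: field_simps power2_eq_square)
  also have "\<dots> \<le> (1 / m + r\<^sup>2 / m\<^sup>2) * (flux_beta m r)\<^sup>2"
    using b m cum2_w_div_pos[OF r] by (intro mult_left_mono power_mono) auto
  finally show ?thesis using flux_beta_pos[OF r] by (simp add: bdry_energy_def divide_le_eq)
qed

text \<open>The defect is nondecreasing and bounded below by a quantity that tends to \<open>0\<close> at \<open>0\<close>.\<close>

lemma mono_defect_nonneg:
  assumes R: "R > 0" shows "mono_defect m R \<ge> 0"
proof -
  \<comment> \<open>Here \<open>I \<le> r K\<close> and \<open>\<beta> \<ge> m K\<close> turn the negative terms into multiples of \<open>K\<close> and \<open>W\<close>.\<close>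
  let ?e = "\<lambda>r. r\<^sup>2 * cum2_w_div m r / m + cum_w m r * (1 / m + r\<^sup>2 / m\<^sup>2)"
  have lower: "- mono_defect m r \<le> ?e r" if r: "r > 0" for r
  proof -
    have "(cum2_w m r)\<^sup>2 / flux_beta m r \<le> r\<^sup>2 * cum2_w_div m r / m"
    proof -
      have "(cum2_w m r)\<^sup>2 \<le> (r * cum2_w_div m r)\<^sup>2"
        using cum2_w_le_mult_cum2_w_div[OF r] cum2_w_pos[OF r] by (intro power_mono) auto
      also have "\<dots> = r\<^sup>2 * cum2_w_div m r / m * (m * cum2_w_div m r)"
        using m by (simp add: power2_eq_square)
      also have "\<dots> \<le> r\<^sup>2 * cum2_w_div m r / m * flux_beta m r"
        using m r cum2_w_div_pos[OF r] cum2_w_pos[OF r] by (intro mult_left_mono) (auto simp: flux_beta_def)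
      finally show ?thesis using flux_beta_pos[OF r] by (simp add: divide_le_eq)
    qed
    moreover have "- (sq_diff m r / flux_beta m r) \<le> (cum2_w m r)\<^sup>2 / flux_beta m r"
      using flux_beta_pos[OF r] m by (simp add: sq_diff_def diff_divide_distrib)
    moreover have "cum_w m r * bdry_energy m r \<le> cum_w m r * (1 / m + r\<^sup>2 / m\<^sup>2)"
      using bdry_energy_le[OF r] cum_w_pos[OF r] by (intro mult_left_mono) auto
    ultimately show ?thesis unfolding mono_defect_def by linarith
  qed
  have "continuous_on {0..} ?e"
    using m by (intro continuous_intros continuous_on_cum2_w_div continuous_on_cum_w) auto
  then have "(?e \<longlongrightarrow> ?e 0) (at 0 within {0..})"
    unfolding continuous_on_def by (auto dest: bspec[of _ _ 0])
  then have lim: "(?e \<longlongrightarrow> 0) (at_right 0)"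
    by (auto intro: tendsto_within_subset)
  have "- mono_defect m R \<le> 0"
  proof (rule tendsto_lowerbound[OF lim])
    show "\<forall>\<^sub>F r in at_right 0. - mono_defect m R \<le> ?e r"
    proof (rule eventually_at_rightI[of 0 R])
      fix r assume "r \<in> {0<..<R}"
      then show "- mono_defect m R \<le> ?e r" using mono_defect_mono[of r R] lower[of r] by auto
    qed (rule R)
  qed simp
  then show ?thesis by simp
qed

lemma inv_gap_antimono:
  assumes "0 < r" "r \<le> s" shows "inv_gap m s \<le> inv_gap m r"
proof (rule DERIV_nonpos_imp_nonincreasing[OF assms(2)])
  fix x assume "r \<le> x" "x \<le> s"
  with assms have x: "x > 0" by simp
  have inv_gap_eq: "inv_gap m = (\<lambda>r. 1 + (sq_diff m r / flux_beta m r) / cum_w m r)"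
    by (simp add: inv_gap_def fun_eq_iff)
  have "(inv_gap m has_real_derivative 0 + (weight m x * sq_sum m x / (flux_beta m x)\<^sup>2 * cum_w m x - sq_diff m x / flux_beta m x * weight m x)
      / (cum_w m x * cum_w m x)) (at x)"
    unfolding inv_gap_eq using m x cum_w_pos[OF x]
    by (intro DERIV_add DERIV_const DERIV_divide sq_diff_flux_beta_has_derivative cum_w_has_derivative) auto
  moreover have "weight m x * sq_sum m x / (flux_beta m x)\<^sup>2 * cum_w m x - sq_diff m x / flux_beta m x * weight m x
      = - (weight m x * mono_defect m x)"
    by (simp add: mono_defect_def bdry_energy_def algebra_simps)
  moreover have "- (weight m x * mono_defect m x) / (cum_w m x * cum_w m x) \<le> 0"
    using mono_defect_nonneg[OF x] weight_nonneg[of m x] by simp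
  ultimately show "\<exists>y. (inv_gap m has_real_derivative y) (at x) \<and> y \<le> 0" by auto
qed

lemma inv_gap_ge_1:
  assumes r: "r > 0" shows "inv_gap m r \<ge> 1"
proof -
  have "bdry_energy m r \<ge> 0" using m by (simp add: bdry_energy_def sq_sum_def)
  then have "sq_diff m r / flux_beta m r \<ge> 0"
    using mono_defect_nonneg[OF r] cum_w_pos[OF r] unfolding mono_defect_def
    by (smt (verit) mult_nonneg_nonneg)
  then have "sq_diff m r \<ge> 0" using flux_beta_pos[OF r] by (simp add: zero_le_divide_iff)
  then show ?thesis using flux_beta_pos[OF r] cum_w_pos[OF r] by (simp add: inv_gap_def)
qed

end

section \<open>The limit of large radius\<close>

text \<open>The integrand is nonnegative, hence absolutely integrable, and the integrals over growing intervals
  converge to the integral over the half-line.\<close>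

lemma incomplete_Gamma_tendsto:
  fixes z :: real
  assumes "z > 0"
  shows "((\<lambda>x. integral {0..x} (\<lambda>t. t powr (z - 1) / exp t)) \<longlongrightarrow> Gamma z) at_top"
proof -
  let ?g = "\<lambda>t::real. t powr (z - 1) / exp t"
  have hi: "(?g has_integral Gamma z) {0..}" by (rule Gamma_integral_real[OF assms])
  have ai: "?g absolutely_integrable_on {0..}"
    using hi by (intro nonnegative_absolutely_integrable_1) auto
  have ai': "?g absolutely_integrable_on {0..x}" for x
    by (rule set_integrable_subset[OF ai]) auto
  have "((\<lambda>b. set_lebesgue_integral lebesgue {0..b} ?g) \<longlongrightarrow> set_lebesgue_integral lebesgue {0..} ?g) at_top"
    by (rule tendsto_set_lebesgue_integral_at_top) (use ai in auto)
  then show ?thesis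
    using hi by (simp add: set_lebesgue_integral_eq_integral(2)[OF ai] set_lebesgue_integral_eq_integral(2)[OF ai']
        integral_unique)
qed

text \<open>The substitution \<open>t = s\<^sup>2/2\<close>, carried out by comparing derivatives: the two sides agree at \<open>0\<close>.\<close>

lemma cum_w_eq_incomplete_Gamma:
  assumes p: "p \<ge> 1" and R: "R > 0"
  shows "cum_w p R = 2 powr ((p - 1) / 2) * integral {0..R\<^sup>2 / 2} (\<lambda>t. t powr ((p + 1) / 2 - 1) / exp t)"
proof -
  let ?g = "\<lambda>t::real. t powr ((p + 1) / 2 - 1) / exp t"
  let ?G = "\<lambda>x. integral {0..x} ?g"
  have int: "?g integrable_on {0..b}" for b
  proof (rule integrable_on_subinterval)
    show "?g integrable_on {0..}" using Gamma_integral_real[of "(p + 1) / 2"] p by auto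
  qed auto
  have contG: "continuous_on {0..} ?G"
    by (intro continuous_on_atLeast_0I indefinite_integral_continuous_1 int)
  have derG: "(?G has_real_derivative ?g x) (at x)" if x: "x > 0" for x
  proof -
    have "continuous (at x within {0..x + 1} - {}) ?g"
      using x by (intro continuous_intros) auto
    from integral_has_vector_derivative_continuous_at[OF int _ _ this] x
    have "(?G has_real_derivative ?g x) (at x within {0..x + 1})"
      by (simp add: has_real_derivative_iff_has_vector_derivative)
    then show ?thesis using x by (subst (asm) at_within_Icc_at) auto
  qed
  define d where "d = (\<lambda>r. cum_w p r - 2 powr ((p - 1) / 2) * ?G (r\<^sup>2 / 2))"
  have "d R = d 0"
  proof (rule DERIV_isconst_end[OF R])
    have "continuous_on {0..R} (\<lambda>r. ?G (r\<^sup>2 / 2))"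
      by (rule continuous_on_compose2[OF contG]) (auto intro!: continuous_intros)
    then show "continuous_on {0..R} d"
      unfolding d_def using p
      by (intro continuous_intros continuous_on_subset[OF continuous_on_cum_w]) auto
    fix x assume x: "0 < x" "x < R"
    have "((\<lambda>r. r\<^sup>2 / 2) has_real_derivative x) (at x)"
      by (auto intro!: derivative_eq_intros)
    from DERIV_chain2[OF derG this]
    have "((\<lambda>r. ?G (r\<^sup>2 / 2)) has_real_derivative ?g (x\<^sup>2 / 2) * x) (at x)" using x by simp
    then have "(d has_real_derivative weight p x - 2 powr ((p - 1) / 2) * (?g (x\<^sup>2 / 2) * x)) (at x)"
      unfolding d_def using p x by (intro DERIV_diff cum_w_has_derivative DERIV_cmult) auto
    moreover have "2 powr ((p - 1) / 2) * (?g (x\<^sup>2 / 2) * x) = weight p x"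
    proof -
      have "(x\<^sup>2 / 2) powr ((p - 1) / 2) = x powr (p - 1) / 2 powr ((p - 1) / 2)"
      proof -
        have "(x\<^sup>2) powr ((p - 1) / 2) = (x powr 2) powr ((p - 1) / 2)" using x by (simp add: powr_numeral)
        also have "\<dots> = x powr (2 * ((p - 1) / 2))" by (simp only: powr_powr)
        also have "2 * ((p - 1) / 2) = p - 1" by (simp only: mult_2 field_sum_of_halves)
        finally show ?thesis using x by (simp add: powr_divide)
      qed
      moreover have "x powr p = x powr (p - 1) * x"
        using x by (simp add: powr_diff)
      moreover have "(p + 1) / 2 - 1 = (p - 1) / 2" by (simp add: field_simps)
      ultimately show ?thesis by (simp add: weight_def exp_minus field_simps)
    qed
    ultimately show "(d has_real_derivative 0) (at x)" by simp
  qed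
  then show ?thesis by (simp add: d_def)
qed

lemma cum_w_tendsto:
  assumes p: "p \<ge> 1"
  shows "(cum_w p \<longlongrightarrow> 2 powr ((p - 1) / 2) * Gamma ((p + 1) / 2)) at_top"
proof -
  have "filterlim (\<lambda>R::real. R\<^sup>2 / 2) at_top at_top" by real_asymp
  from filterlim_compose[OF incomplete_Gamma_tendsto this, of "(p + 1) / 2"] p
  have "((\<lambda>R. 2 powr ((p - 1) / 2) * integral {0..R\<^sup>2 / 2} (\<lambda>t. t powr ((p + 1) / 2 - 1) / exp t))
     \<longlongrightarrow> 2 powr ((p - 1) / 2) * Gamma ((p + 1) / 2)) at_top"
    by (intro tendsto_mult tendsto_const) auto
  then show ?thesis
    by (rule Lim_transform_eventually)
       (use eventually_gt_at_top[of 0] in eventually_elim, simp add: cum_w_eq_incomplete_Gamma[OF p])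
qed

lemma weight_tendsto_0: "(weight m \<longlongrightarrow> 0) at_top"
  unfolding weight_def[abs_def] by real_asymp

text \<open>Dividing \<open>I\<close> and \<open>K\<close> by \<open>r\<close> gives quantities with the limits \<open>W(\<infinity>)\<close> and \<open>F(\<infinity>)\<close>, in terms of
  which \<open>inv_gap\<close> tends to \<open>m F(\<infinity>)\<^sup>2 / W(\<infinity>)\<^sup>2\<close>.\<close>

lemma inv_gap_tendsto:
  assumes m: "m \<ge> 1"
  shows "(inv_gap m \<longlongrightarrow> 1 / (1 - kappa m)) at_top" "kappa m < 1"
proof -
  \<comment> \<open>The limits of \<open>W\<close> and of \<open>m F\<close>.\<close>
  define w0 where "w0 = 2 powr ((m - 1) / 2) * Gamma ((m + 1) / 2)"
  define v0 where "v0 = 2 powr (m / 2) * Gamma (m / 2 + 1)"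
  have pos: "w0 > 0" "v0 > 0" using m by (auto simp: w0_def v0_def Gamma_real_pos)
  have W: "(cum_w m \<longlongrightarrow> w0) at_top"
    unfolding w0_def by (rule cum_w_tendsto[OF m])
  have V: "(cum_w (m + 1) \<longlongrightarrow> v0) at_top"
    using cum_w_tendsto[of "m + 1"] m by (simp add: v0_def add_divide_distrib add.commute)
  have F: "(cum_w_div m \<longlongrightarrow> v0 / m) at_top"
    using tendsto_divide[OF tendsto_add[OF weight_tendsto_0[of m] V] tendsto_const[of m]] m
    unfolding cum_w_div_def[abs_def] by simp
  have inv: "((\<lambda>r::real. 1 / r) \<longlongrightarrow> 0) at_top" by real_asymp
  define i where "i = (\<lambda>r. cum_w m r - cum_w (m + 1) r * (1 / r))"
  define k where "k = (\<lambda>r. cum_w_div m r - cum_w m r * (1 / r))"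
  have i: "(i \<longlongrightarrow> w0) at_top" unfolding i_def
    using tendsto_diff[OF W tendsto_mult[OF V inv]] by simp
  have k: "(k \<longlongrightarrow> v0 / m) at_top" unfolding k_def
    using tendsto_diff[OF F tendsto_mult[OF W inv]] by simp
  have "((\<lambda>r. 1 + (m * (k r)\<^sup>2 - (i r)\<^sup>2) / (cum_w m r * (i r + m * k r * (1 / r))))
     \<longlongrightarrow> 1 + (m * (v0 / m)\<^sup>2 - w0\<^sup>2) / (w0 * (w0 + m * (v0 / m) * 0))) at_top"
    using pos by (intro tendsto_intros i k W inv) auto
  moreover have "1 + (m * (v0 / m)\<^sup>2 - w0\<^sup>2) / (w0 * (w0 + m * (v0 / m) * 0)) = v0\<^sup>2 / (m * w0\<^sup>2)"
    using pos m by (simp add: field_simps power2_eq_square)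
  ultimately have "((\<lambda>r. 1 + (m * (k r)\<^sup>2 - (i r)\<^sup>2) / (cum_w m r * (i r + m * k r * (1 / r))))
     \<longlongrightarrow> v0\<^sup>2 / (m * w0\<^sup>2)) at_top" by simp
  then have lim: "(inv_gap m \<longlongrightarrow> v0\<^sup>2 / (m * w0\<^sup>2)) at_top"
  proof (rule Lim_transform_eventually)
    show "\<forall>\<^sub>F r in at_top. 1 + (m * (k r)\<^sup>2 - (i r)\<^sup>2) / (cum_w m r * (i r + m * k r * (1 / r))) = inv_gap m r"
      using eventually_gt_at_top[of 0]
    proof eventually_elim
      case (elim r)
      have I: "cum2_w m r = r * i r" and K: "cum2_w_div m r = r * k r"
        using elim by (simp_all add: cum2_w_def cum2_w_div_def i_def k_def field_simps)
      have "sq_diff m r = r\<^sup>2 * (m * (k r)\<^sup>2 - (i r)\<^sup>2)"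
        by (simp add: sq_diff_def I K power2_eq_square algebra_simps)
      moreover have "cum_w m r * flux_beta m r = r\<^sup>2 * (cum_w m r * (i r + m * k r * (1 / r)))"
        using elim by (simp add: flux_beta_def I K power2_eq_square algebra_simps)
      ultimately show ?case using elim cum_w_pos[OF m elim]
        unfolding inv_gap_def by (simp only: mult_divide_mult_cancel_left_if) simp
    qed
  qed
  have v0_eq: "v0 = 2 powr (m / 2) * (m / 2 * Gamma (m / 2))"
    using m Gamma_plus1[of "m / 2"] by (simp add: v0_def nonpos_Ints_def)
  have powr_sq: "(2 powr x)\<^sup>2 = 2 powr (2 * x)" for x :: real
    by (simp add: power2_eq_square flip: powr_add)
  have g: "Gamma ((m + 1) / 2) > 0" "Gamma (m / 2) > 0"
    using m by (auto simp: Gamma_real_pos)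
  have p2: "(2::real) powr m = 2 * 2 powr (m - 1)" by (simp add: powr_diff)
  have eq: "m * w0\<^sup>2 / v0\<^sup>2 = 1 - kappa m"
  proof -
    have e: "2 * ((m - 1) / 2) = m - 1" "2 * (m / 2) = m" by simp_all
    have "m * (P * A) / (2 * P * ((m / 2)\<^sup>2 * B)) = 1 - (1 - 2 / m * (A / B))" if "P > 0" "B > 0" for P A B
      using that m by (simp add: power2_eq_square field_simps)
    from this[of "2 powr (m - 1)" "(Gamma (m / 2))\<^sup>2" "(Gamma ((m + 1) / 2))\<^sup>2"]
    show ?thesis
      using g unfolding w0_def v0_eq kappa_def power_mult_distrib powr_sq e p2 by simp
  qed
  have "m * w0\<^sup>2 / v0\<^sup>2 > 0" using pos m by simp
  then show "kappa m < 1" using eq by simp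
  have "v0\<^sup>2 / (m * w0\<^sup>2) = 1 / (m * w0\<^sup>2 / v0\<^sup>2)" by simp
  then show "(inv_gap m \<longlongrightarrow> 1 / (1 - kappa m)) at_top" using lim by (simp only: eq)
qed

section \<open>Weighted square-integrable functions\<close>

lemma borel_measurable_weight: "weight m \<in> borel_measurable (lebesgue_on A)"
proof -
  have "weight m \<in> borel_measurable borel"
    unfolding weight_def[abs_def] by measurable
  then show ?thesis
    by (intro measurable_restrict_space1 measurable_completion) simp
qed

lemma borel_measurable_ident_lebesgue_on: "(\<lambda>r::real. r) \<in> borel_measurable (lebesgue_on A)"
  using id_borel_measurable_lebesgue_on[of A] by (simp add: id_def)

lemma continuous_integrable_open_interval:
  fixes f :: "real \<Rightarrow> real"
  assumes "continuous_on {a..b} f"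
  shows "integrable (lebesgue_on {a<..<b}) f"
    and "(\<integral>r. f r \<partial>lebesgue_on {a<..<b}) = integral {a..b} f"
proof -
  have "f absolutely_integrable_on {a<..<b}"
    by (rule set_integrable_subset[OF absolutely_integrable_continuous_real[OF assms]]) auto
  then show i: "integrable (lebesgue_on {a<..<b}) f"
    by (intro absolutely_integrable_imp_integrable) auto
  show "(\<integral>r. f r \<partial>lebesgue_on {a<..<b}) = integral {a..b} f"
    using lebesgue_integral_eq_integral[OF i] by (simp add: integral_open_interval_real)
qed

lemma integrable_weight:
  assumes "p > 0"
  shows "integrable (lebesgue_on {0<..<R}) (weight p)"
    and "(\<integral>r. weight p r \<partial>lebesgue_on {0<..<R}) = cum_w p R"
  using continuous_integrable_open_interval[of 0 R "weight p"]
    continuous_on_subset[OF continuous_on_weight[OF assms], of "{0..R}"]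
  by (auto simp: cum_w_def)

lemma total_weight_eq: "m > 0 \<Longrightarrow> total_weight m R = cum_w m R"
  by (simp add: total_weight_def integrable_weight)

lemma expect_eq:
  assumes "m > 0" "cum_w m R > 0" and f: "f \<in> borel_measurable (lebesgue_on {0<..<R})"
  shows "expect m R f = (\<integral>r. f r * weight m r \<partial>lebesgue_on {0<..<R}) / cum_w m R"
proof -
  have "expect m R f = (\<integral>r. (weight m r / cum_w m R) *\<^sub>R f r \<partial>lebesgue_on {0<..<R})"
    unfolding expect_def mu_def total_weight_eq[OF assms(1)]
    using assms(2) by (intro integral_density f borel_measurable_divide borel_measurable_weight)
      (auto simp: weight_nonneg)
  also have "\<dots> = (\<integral>r. (f r * weight m r) / cum_w m R \<partial>lebesgue_on {0<..<R})"
    by (simp add: mult.commute)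
  finally show ?thesis by simp
qed

lemma L2_measurable: "f \<in> L2 m R \<Longrightarrow> f \<in> borel_measurable (lebesgue_on {0<..<R})"
  by (simp add: L2_def)

lemma L2_mult_integrable:
  assumes "f \<in> L2 m R" "g \<in> L2 m R"
  shows "integrable (lebesgue_on {0<..<R}) (\<lambda>r. f r * g r * weight m r)"
proof (rule Bochner_Integration.integrable_bound)
  show "integrable (lebesgue_on {0<..<R}) (\<lambda>r. (f r)\<^sup>2 * weight m r + (g r)\<^sup>2 * weight m r)"
    using assms by (auto simp: L2_def)
  show "(\<lambda>r. f r * g r * weight m r) \<in> borel_measurable (lebesgue_on {0<..<R})"
    using assms by (intro borel_measurable_times borel_measurable_weight L2_measurable)
  have "\<bar>x * y\<bar> \<le> x\<^sup>2 + y\<^sup>2" for x y :: real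
  proof -
    have "2 * \<bar>x * y\<bar> \<le> x\<^sup>2 + y\<^sup>2"
      using zero_le_power2[of "\<bar>x\<bar> - \<bar>y\<bar>"] by (simp add: power2_diff abs_mult)
    then show ?thesis by linarith
  qed
  then have "\<bar>x * y * weight m r\<bar> \<le> x\<^sup>2 * weight m r + y\<^sup>2 * weight m r" for x y r
    using mult_right_mono[OF _ weight_nonneg, of "\<bar>x * y\<bar>" "x\<^sup>2 + y\<^sup>2" m r]
    by (simp add: abs_mult weight_nonneg distrib_right)
  then show "AE r in lebesgue_on {0<..<R}. norm (f r * g r * weight m r)
      \<le> norm ((f r)\<^sup>2 * weight m r + (g r)\<^sup>2 * weight m r)"
    by (intro AE_I2) (smt (verit) real_norm_def)
qed

lemma L2_add:
  assumes "f \<in> L2 m R" "g \<in> L2 m R"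
  shows "(\<lambda>r. f r + g r) \<in> L2 m R"
proof -
  have "integrable (lebesgue_on {0<..<R})
      (\<lambda>r. f r * f r * weight m r + 2 * (f r * g r * weight m r) + g r * g r * weight m r)"
    by (intro Bochner_Integration.integrable_add integrable_mult_right L2_mult_integrable assms)
  moreover have "(\<lambda>r. f r * f r * weight m r + 2 * (f r * g r * weight m r) + g r * g r * weight m r)
      = (\<lambda>r. (f r + g r)\<^sup>2 * weight m r)"
    by (auto simp: fun_eq_iff power2_eq_square algebra_simps)
  ultimately show ?thesis using assms by (auto simp: L2_def)
qed

lemma L2_mult_bounded:
  assumes f: "f \<in> L2 m R" and b: "b \<in> borel_measurable (lebesgue_on {0<..<R})"
    and C: "\<And>r. r \<in> {0<..<R} \<Longrightarrow> \<bar>b r\<bar> \<le> C"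
  shows "(\<lambda>r. b r * f r) \<in> L2 m R"
proof -
  have "integrable (lebesgue_on {0<..<R}) (\<lambda>r. (b r * f r)\<^sup>2 * weight m r)"
  proof (rule Bochner_Integration.integrable_bound)
    show "integrable (lebesgue_on {0<..<R}) (\<lambda>r. C\<^sup>2 * ((f r)\<^sup>2 * weight m r))"
      using f by (auto simp: L2_def)
    show "(\<lambda>r. (b r * f r)\<^sup>2 * weight m r) \<in> borel_measurable (lebesgue_on {0<..<R})"
      using L2_measurable[OF f] b
      by (intro borel_measurable_times borel_measurable_power borel_measurable_weight)
    have "norm ((b r * f r)\<^sup>2 * weight m r) \<le> norm (C\<^sup>2 * ((f r)\<^sup>2 * weight m r))" if "r \<in> {0<..<R}" for r
    proof -
      have "(b r)\<^sup>2 \<le> C\<^sup>2" using C[OF that] by (metis abs_ge_zero power2_abs power_mono)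
      then have "(b r)\<^sup>2 * ((f r)\<^sup>2 * weight m r) \<le> C\<^sup>2 * ((f r)\<^sup>2 * weight m r)"
        by (intro mult_right_mono) (auto simp: weight_nonneg)
      then show ?thesis by (simp add: power_mult_distrib weight_nonneg mult.assoc)
    qed
    then show "AE r in lebesgue_on {0<..<R}. norm ((b r * f r)\<^sup>2 * weight m r)
        \<le> norm (C\<^sup>2 * ((f r)\<^sup>2 * weight m r))"
      by (intro AE_I2) auto
  qed
  moreover have "(\<lambda>r. b r * f r) \<in> borel_measurable (lebesgue_on {0<..<R})"
    using L2_measurable[OF f] b by (rule borel_measurable_times[rotated])
  ultimately show ?thesis by (simp add: L2_def)
qed

lemma L2_cmult: "f \<in> L2 m R \<Longrightarrow> (\<lambda>r. c * f r) \<in> L2 m R"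
  by (rule L2_mult_bounded[where C="\<bar>c\<bar>"]) auto

lemma L2_diff:
  assumes "f \<in> L2 m R" "g \<in> L2 m R"
  shows "(\<lambda>r. f r - g r) \<in> L2 m R"
  using L2_add[OF assms(1) L2_cmult[OF assms(2), of "-1"]] by simp

lemma L2_const: "m > 0 \<Longrightarrow> (\<lambda>r. c) \<in> L2 m R"
  by (simp add: L2_def integrable_weight)

lemma L2_bounded:
  assumes "m > 0" "b \<in> borel_measurable (lebesgue_on {0<..<R})"
    and "\<And>r. r \<in> {0<..<R} \<Longrightarrow> \<bar>b r\<bar> \<le> C"
  shows "b \<in> L2 m R"
  using L2_mult_bounded[OF L2_const[OF assms(1), of 1] assms(2,3)] by simp

lemma L2_integrable:
  assumes "m > 0" "f \<in> L2 m R"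
  shows "integrable (lebesgue_on {0<..<R}) (\<lambda>r. f r * weight m r)"
  using L2_mult_integrable[OF assms(2) L2_const[OF assms(1), of 1]] by simp

lemma L2_cong_AE:
  assumes "f \<in> L2 m R" "g \<in> borel_measurable (lebesgue_on {0<..<R})"
    "AE r in lebesgue_on {0<..<R}. g r = f r"
  shows "g \<in> L2 m R"
proof -
  have "integrable (lebesgue_on {0<..<R}) (\<lambda>r. (g r)\<^sup>2 * weight m r)"
  proof (rule integrable_cong_AE_imp[where g="\<lambda>r. (f r)\<^sup>2 * weight m r"])
    show "(\<lambda>r. (g r)\<^sup>2 * weight m r) \<in> borel_measurable (lebesgue_on {0<..<R})"
      by (intro borel_measurable_times borel_measurable_power borel_measurable_weight assms)
    show "AE r in lebesgue_on {0<..<R}. (f r)\<^sup>2 * weight m r = (g r)\<^sup>2 * weight m r"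
      using assms(3) by eventually_elim simp
  qed (use assms in \<open>auto simp: L2_def\<close>)
  with assms(2) show ?thesis by (simp add: L2_def)
qed

lemma L2_of_sum_integrable:
  assumes "f \<in> borel_measurable (lebesgue_on {0<..<R})" "g \<in> borel_measurable (lebesgue_on {0<..<R})"
    and i: "integrable (lebesgue_on {0<..<R}) (\<lambda>r. ((f r)\<^sup>2 + (g r)\<^sup>2) * weight m r)"
  shows "f \<in> L2 m R"
proof -
  have "integrable (lebesgue_on {0<..<R}) (\<lambda>r. (f r)\<^sup>2 * weight m r)"
    by (rule Bochner_Integration.integrable_bound[OF i])
       (auto intro!: borel_measurable_times borel_measurable_power borel_measurable_weight assms AE_I2
         mult_right_mono simp: weight_nonneg)
  with assms(1) show ?thesis by (simp add: L2_def)
qed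

section \<open>Integration by parts in the weighted Sobolev space\<close>

lemma H1_L2:
  assumes v: "v \<in> H1 m R"
  shows "has_weak_derivative R v (weak_deriv R v)" "v \<in> L2 m R" "weak_deriv R v \<in> L2 m R" "T R v \<in> L2 m R"
proof -
  have "\<exists>d. has_weak_derivative R v d" using v by (auto simp: H1_def H1_loc_def)
  then show wd: "has_weak_derivative R v (weak_deriv R v)"
    unfolding weak_deriv_def by (rule someI_ex)
  then have meas: "v \<in> borel_measurable (lebesgue_on {0<..<R})"
      "weak_deriv R v \<in> borel_measurable (lebesgue_on {0<..<R})"
    by (auto simp: has_weak_derivative_def L1_loc_def)
  have i: "integrable (lebesgue_on {0<..<R}) (\<lambda>r. ((v r)\<^sup>2 + (weak_deriv R v r)\<^sup>2) * weight m r)"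
    using v by (simp add: H1_def)
  show v2: "v \<in> L2 m R" by (rule L2_of_sum_integrable[OF meas i])
  show d2: "weak_deriv R v \<in> L2 m R"
    by (rule L2_of_sum_integrable[OF meas(2,1)]) (use i in \<open>simp add: add.commute\<close>)
  have "(\<lambda>r. r * v r) \<in> L2 m R"
    by (rule L2_mult_bounded[OF v2 borel_measurable_ident_lebesgue_on, of R]) auto
  from L2_diff[OF this d2] show "T R v \<in> L2 m R"
    unfolding T_def[abs_def] .
qed

text \<open>A smooth function \<open>q\<close> that vanishes to first order at \<open>R\<close>, and like \<open>r w\<close> at \<open>0\<close>, behaves like
  a test function. With a cutoff it is one; the derivative of the cutoff is at most
  a constant times \<open>1/r + 1/(R - r) = R/(r (R - r))\<close>, so that all terms are dominated by a multiple of
  \<open>(\<bar>v\<bar> + \<bar>v'\<bar>) w\<close>.\<close>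

lemma H1_integral_by_parts:
  assumes m: "m > 0" and R: "R > 0" and v: "v \<in> H1 m R"
    and q: "\<And>k. smooth_upto k {0<..<R} q"
    and qC: "\<And>r. r \<in> {0<..<R} \<Longrightarrow> \<bar>q r\<bar> \<le> C * (r * (R - r)) * weight m r"
    and q'C: "\<And>r. r \<in> {0<..<R} \<Longrightarrow> \<bar>deriv q r\<bar> \<le> C * weight m r"
  shows "(\<integral>r. weak_deriv R v r * q r + v r * deriv q r \<partial>lebesgue_on {0<..<R}) = 0"
proof -
  let ?M = "lebesgue_on {0<..<R}" and ?d = "weak_deriv R v"
  note wd = H1_L2(1)[OF v] and v2 = H1_L2(2)[OF v] and d2 = H1_L2(3)[OF v]
  have loc: "v \<in> L1_loc R" "?d \<in> L1_loc R" using wd by (auto simp: has_weak_derivative_def)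
  obtain B where B: "B > 0" "\<And>a b n x. a < x \<Longrightarrow> x < b \<Longrightarrow>
      \<bar>deriv (cutoff a b n) x\<bar> \<le> B * (1 / (x - a) + 1 / (b - x))"
    using deriv_cutoff_bounded by metis
  define \<phi> where "\<phi> = (\<lambda>n r. cutoff 0 R (Suc n) r * q r)"
  have test: "\<phi> n \<in> test_functions R" for n
    unfolding \<phi>_def by (rule cutoff_mult_test_function[OF _ R _ q]) auto
  have q_der: "(q has_real_derivative deriv q r) (at r)" if "r \<in> {0<..<R}" for r
    by (rule smooth_upto_has_derivative[OF q that])
  have \<phi>_der: "deriv (\<phi> n) r = deriv (cutoff 0 R (Suc n)) r * q r + cutoff 0 R (Suc n) r * deriv q r"
    if "r \<in> {0<..<R}" for n r
    unfolding \<phi>_def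
    using DERIV_imp_deriv[OF DERIV_mult[OF cutoff_has_derivative[of 0 R "Suc n" r] q_der[OF that]]]
    by (simp add: mult.commute)
  define s where "s = (\<lambda>n r. ?d r * \<phi> n r + v r * deriv (\<phi> n) r)"
  have zero: "(\<integral>r. s n r \<partial>?M) = 0" for n
    using wd test[of n] L1_loc_mult_test_function[OF loc(2) test[of n]]
      L1_loc_mult_deriv_test_function[OF loc(1) test[of n]]
    by (simp add: s_def has_weak_derivative_def)
  have s_eq: "s n r = cutoff 0 R (Suc n) r * (?d r * q r + v r * deriv q r)
      + deriv (cutoff 0 R (Suc n)) r * q r * v r" if "r \<in> {0<..<R}" for n r
    unfolding s_def \<phi>_der[OF that] by (simp add: \<phi>_def algebra_simps)
  have C: "C \<ge> 0"
  proof -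
    have "0 \<le> C * weight m (R / 2)" using q'C[of "R / 2"] R by (auto intro: order_trans[OF abs_ge_zero])
    then show ?thesis using weight_pos[of "R / 2" m] R by (simp add: zero_le_mult_iff)
  qed
  have "(\<lambda>n. \<integral>r. s n r \<partial>?M) \<longlonglongrightarrow> (\<integral>r. ?d r * q r + v r * deriv q r \<partial>?M)"
  proof (rule integral_dominated_convergence[where
        w="\<lambda>r. C * R\<^sup>2 * (\<bar>?d r\<bar> * weight m r) + (C + B * C * R) * (\<bar>v r\<bar> * weight m r)"])
    have abs: "(\<lambda>r. \<bar>f r\<bar>) \<in> L2 m R" if "f \<in> L2 m R" for f
      using that by (auto simp: L2_def)
    show "integrable ?M (\<lambda>r. C * R\<^sup>2 * (\<bar>?d r\<bar> * weight m r) + (C + B * C * R) * (\<bar>v r\<bar> * weight m r))"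
      by (intro Bochner_Integration.integrable_add integrable_mult_right L2_integrable[OF m] abs v2 d2)
    have "q \<in> borel_measurable ?M" "deriv q \<in> borel_measurable ?M"
    proof -
      have "continuous_on {0<..<R} q"
        using q_der by (intro continuous_at_imp_continuous_on ballI DERIV_isCont)
      then show "q \<in> borel_measurable ?M" by (intro continuous_imp_measurable_on_sets_lebesgue) auto
      have "continuous_on {0<..<R} (deriv q)"
        using smooth_upto_has_derivative[OF smooth_upto_deriv[OF q]]
        by (intro continuous_at_imp_continuous_on ballI DERIV_isCont)
      then show "deriv q \<in> borel_measurable ?M" by (intro continuous_imp_measurable_on_sets_lebesgue) auto
    qed
    then show "(\<lambda>r. ?d r * q r + v r * deriv q r) \<in> borel_measurable ?M"
      by (intro borel_measurable_add borel_measurable_times L2_measurable[OF v2] L2_measurable[OF d2])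
    show "s n \<in> borel_measurable ?M" for n
      unfolding s_def using L1_loc_mult_test_function[OF loc(2) test[of n]]
        L1_loc_mult_deriv_test_function[OF loc(1) test[of n]]
      by (intro borel_measurable_add borel_measurable_integrable)
    show "AE r in ?M. (\<lambda>n. s n r) \<longlonglongrightarrow> ?d r * q r + v r * deriv q r"
    proof (rule AE_I2)
      fix r assume "r \<in> space ?M"
      then have r: "r \<in> {0<..<R}" by simp
      then have "\<forall>\<^sub>F n in sequentially. s n r = ?d r * q r + v r * deriv q r"
        using cutoff_eventually_1[of 0 r R] by (auto simp: s_eq elim!: eventually_mono)
      then show "(\<lambda>n. s n r) \<longlonglongrightarrow> ?d r * q r + v r * deriv q r" by (rule tendsto_eventually)
    qed
    show "AE r in ?M. norm (s n r) \<le> C * R\<^sup>2 * (\<bar>?d r\<bar> * weight m r) + (C + B * C * R) * (\<bar>v r\<bar> * weight m r)" for n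
    proof (rule AE_I2)
      fix r assume "r \<in> space ?M"
      then have r: "0 < r" "r < R" by auto
      define w where "w = weight m r"
      have w: "w \<ge> 0" by (simp add: w_def weight_nonneg)
      have q1: "\<bar>q r\<bar> \<le> C * (r * (R - r)) * w" and q2: "\<bar>deriv q r\<bar> \<le> C * w"
        using qC q'C r by (auto simp: w_def)
      have "r * (R - r) \<le> R * R" using r by (intro mult_mono) auto
      then have "C * (r * (R - r)) * w \<le> C * (R * R) * w"
        using C w by (intro mult_right_mono mult_left_mono) auto
      with q1 have q3: "\<bar>q r\<bar> \<le> C * R\<^sup>2 * w" by (simp add: power2_eq_square)
      have "\<bar>deriv (cutoff 0 R (Suc n)) r * q r\<bar> \<le> B * (1 / (r - 0) + 1 / (R - r)) * (C * (r * (R - r)) * w)"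
        unfolding abs_mult using B(2)[OF r] q1 r by (intro mult_mono) (use B(1) in auto)
      also have "\<dots> = B * C * R * w" using r by (simp add: field_simps)
      finally have q4: "\<bar>deriv (cutoff 0 R (Suc n)) r * q r\<bar> \<le> B * C * R * w" .
      have "\<bar>s n r\<bar> \<le> \<bar>cutoff 0 R (Suc n) r * (?d r * q r + v r * deriv q r)\<bar>
          + \<bar>deriv (cutoff 0 R (Suc n)) r * q r * v r\<bar>"
        using r by (subst s_eq) auto
      also have "\<bar>cutoff 0 R (Suc n) r * (?d r * q r + v r * deriv q r)\<bar> \<le> \<bar>?d r * q r + v r * deriv q r\<bar>"
        using cutoff_bounds[of 0 R "Suc n" r] by (simp add: abs_mult mult_left_le_one_le)
      also have "\<dots> \<le> \<bar>?d r\<bar> * \<bar>q r\<bar> + \<bar>v r\<bar> * \<bar>deriv q r\<bar>"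
        by (metis abs_mult abs_triangle_ineq)
      also have "\<dots> \<le> \<bar>?d r\<bar> * (C * R\<^sup>2 * w) + \<bar>v r\<bar> * (C * w)"
        using q2 q3 by (intro add_mono mult_left_mono) auto
      also have "\<bar>deriv (cutoff 0 R (Suc n)) r * q r * v r\<bar> \<le> (B * C * R * w) * \<bar>v r\<bar>"
        unfolding abs_mult[of _ "v r"] using q4 by (intro mult_right_mono) auto
      finally show "norm (s n r) \<le> C * R\<^sup>2 * (\<bar>?d r\<bar> * weight m r) + (C + B * C * R) * (\<bar>v r\<bar> * weight m r)"
        by (simp add: w_def algebra_simps)
    qed
  qed
  then show ?thesis by (simp add: zero LIMSEQ_const_iff)
qed

lemma L1_loc_continuous:
  assumes "continuous_on {0<..<R} f"
  shows "f \<in> L1_loc R"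
proof -
  have "integrable (lebesgue_on K) f" if K: "compact K" "K \<subseteq> {0<..<R}" for K
  proof -
    have cont: "continuous_on K f" by (rule continuous_on_subset[OF assms K(2)])
    then obtain B where B: "\<And>x. x \<in> K \<Longrightarrow> norm (f x) \<le> B"
      using compact_imp_bounded[OF compact_continuous_image[OF cont K(1)]] by (auto simp: bounded_iff)
    have "K \<in> lmeasurable" using K(1) by (rule lmeasurable_compact)
    then interpret finite_measure "lebesgue_on K" by (rule finite_measure_lebesgue_on)
    show ?thesis
    proof (rule integrable_const_bound[of _ B])
      show "f \<in> borel_measurable (lebesgue_on K)"
        using cont \<open>K \<in> lmeasurable\<close> by (intro continuous_imp_measurable_on_sets_lebesgue) auto
    qed (use B in \<open>auto intro!: AE_I2\<close>)
  qed
  moreover have "f \<in> borel_measurable (lebesgue_on {0<..<R})"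
    by (intro continuous_imp_measurable_on_sets_lebesgue assms) auto
  ultimately show ?thesis by (auto simp: L1_loc_def)
qed

lemma L2_loc_continuous:
  assumes "continuous_on {0<..<R} f"
  shows "f \<in> L2_loc R"
  using L1_loc_continuous[OF assms] L1_loc_continuous[OF continuous_on_power[OF assms, of 2]]
  by (auto simp: L1_loc_def L2_loc_def)

lemma has_weak_derivative_classical:
  assumes v: "\<And>r. r \<in> {0<..<R} \<Longrightarrow> (v has_real_derivative v' r) (at r)"
    and v': "continuous_on {0<..<R} v'"
  shows "has_weak_derivative R v v'"
proof -
  let ?M = "lebesgue_on {0<..<R}"
  have cv: "continuous_on {0<..<R} v"
    using v by (intro continuous_at_imp_continuous_on ballI DERIV_isCont)
  note loc = L1_loc_continuous[OF cv] L1_loc_continuous[OF v']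
  have "(\<integral>r. v r * deriv \<phi> r \<partial>?M) = - (\<integral>r. v' r * \<phi> r \<partial>?M)" if \<phi>: "\<phi> \<in> test_functions R" for \<phi>
    using \<phi>
  proof (cases rule: test_function_support)
    case (1 a b)
    let ?h = "\<lambda>r. v r * deriv \<phi> r + v' r * \<phi> r"
    have sub: "{a..b} \<subseteq> {0<..<R}" using 1 by auto
    have ch: "continuous_on {a..b} ?h"
      by (intro continuous_intros continuous_on_subset[OF cv sub] continuous_on_subset[OF v' sub]
          test_function_continuous[OF \<phi>])
    have "(?h has_integral (v b * \<phi> b - v a * \<phi> a)) {a..b}"
    proof (rule fundamental_theorem_of_calculus)
      fix x assume "x \<in> {a..b}"
      then have x: "x \<in> {0<..<R}" using sub by auto
      have "((\<lambda>r. v r * \<phi> r) has_real_derivative v' x * \<phi> x + deriv \<phi> x * v x) (at x)"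
        by (rule DERIV_mult[OF v[OF x] test_function_continuous(1)[OF \<phi>]])
      then show "((\<lambda>r. v r * \<phi> r) has_vector_derivative v x * deriv \<phi> x + v' x * \<phi> x) (at x within {a..b})"
        by (auto simp: ac_simps has_real_derivative_iff_has_vector_derivative[symmetric]
            intro: has_field_derivative_at_within)
    qed (use 1 in simp)
    then have 0: "integral {a..b} ?h = 0"
      using 1(4)[of a] 1(4)[of b] by (auto dest: integral_unique)
    have "(\<integral>r. ?h r \<partial>?M) = (\<integral>r. indicator {0<..<R} r * ?h r \<partial>lebesgue)"
      by (subst integral_restrict_space) auto
    also have "\<dots> = (\<integral>r. indicator {a..b} r * ?h r \<partial>lebesgue)"
    proof (rule Bochner_Integration.integral_cong)
      fix r
      show "indicator {0<..<R} r * ?h r = indicator {a..b} r * ?h r"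
      proof (cases "r \<in> {a..b}")
        case True
        then show ?thesis using sub by auto
      next
        case False
        then have "deriv \<phi> r = 0" "\<phi> r = 0"
          using deriv_test_function_eq_0[OF 1(4)] 1(4)[of r] by auto
        then show ?thesis by simp
      qed
    qed simp
    also have "\<dots> = (\<integral>r. ?h r \<partial>lebesgue_on {a..b})"
      by (subst integral_restrict_space) auto
    also have "\<dots> = integral {a..b} ?h"
      using continuous_imp_integrable_real[OF ch] by (intro lebesgue_integral_eq_integral) auto
    finally show ?thesis
      using 0 L1_loc_mult_test_function[OF loc(2) \<phi>] L1_loc_mult_deriv_test_function[OF loc(1) \<phi>] by simp
  qed simp
  with loc show ?thesis by (auto simp: has_weak_derivative_def)
qed

text \<open>Boundedness places \<open>v\<close> and \<open>v'\<close> in the weighted \<open>L\<^sup>2\<close> space. The weak derivative selected for \<open>v\<close>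
  is an arbitrary one, so that it agrees with \<open>v'\<close> only almost everywhere, by uniqueness.\<close>

lemma H1_classical:
  assumes m: "m > 0" and v: "\<And>r. r \<in> {0<..<R} \<Longrightarrow> (v has_real_derivative v' r) (at r)"
    and v': "continuous_on {0<..<R} v'"
    and B: "\<And>r. r \<in> {0<..<R} \<Longrightarrow> \<bar>v r\<bar> \<le> B" "\<And>r. r \<in> {0<..<R} \<Longrightarrow> \<bar>v' r\<bar> \<le> B"
  shows "v \<in> H1 m R" "AE r in lebesgue_on {0<..<R}. weak_deriv R v r = v' r"
proof -
  let ?M = "lebesgue_on {0<..<R}"
  have wd: "has_weak_derivative R v v'" by (rule has_weak_derivative_classical[OF v v'])
  then have wd': "has_weak_derivative R v (weak_deriv R v)"
    unfolding weak_deriv_def by (rule someI[of "has_weak_derivative R v"])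
  from has_weak_derivative_unique[OF this wd]
  show ae: "AE r in ?M. weak_deriv R v r = v' r" .
  have cv: "continuous_on {0<..<R} v"
    using v by (intro continuous_at_imp_continuous_on ballI DERIV_isCont)
  have meas: "v \<in> borel_measurable ?M" "v' \<in> borel_measurable ?M" "weak_deriv R v \<in> borel_measurable ?M"
    using wd wd' by (auto simp: has_weak_derivative_def L1_loc_def)
  have "v \<in> L2 m R" "v' \<in> L2 m R" using L2_bounded[OF m _ B(1)] L2_bounded[OF m _ B(2)] meas by auto
  with L2_cong_AE[OF _ meas(3) ae] have "v \<in> L2 m R" "weak_deriv R v \<in> L2 m R" by auto
  then have "integrable ?M (\<lambda>r. ((v r)\<^sup>2 + (weak_deriv R v r)\<^sup>2) * weight m r)"
    by (simp add: L2_def distrib_right)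
  then show "v \<in> H1 m R"
    using wd L2_loc_continuous[OF cv] L2_loc_continuous[OF v'] by (auto simp: H1_def H1_loc_def)
qed

section \<open>The saddle point\<close>

lemma smooth_upto_weight: "smooth_upto k {0<..} (weight p)"
proof -
  have "smooth_upto k {0<..} (\<lambda>r::real. (-1 / 2) * (r * r))"
    by (intro smooth_upto_mult smooth_upto_const smooth_upto_ident open_greaterThan)
  from smooth_upto_compose[OF open_greaterThan open_UNIV this smooth_upto_exp]
  have "smooth_upto k {0<..} (\<lambda>r. exp ((-1 / 2) * (r * r)))" by simp
  from smooth_upto_mult[OF open_greaterThan smooth_upto_powr[of k p] this]
  show ?thesis unfolding weight_def[abs_def] by (simp add: power2_eq_square)
qed

lemma smooth_upto_cum_w:
  assumes "p > 0" shows "smooth_upto k {0<..} (cum_w p)"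
proof -
  have "smooth_upto (Suc k) {0<..} (cum_w p)"
    by (rule smooth_upto_SucI[OF open_greaterThan _ smooth_upto_weight])
       (use cum_w_has_derivative[OF assms] in auto)
  then show ?thesis by (rule smooth_upto_SucD)
qed

text \<open>Makes \<open>F/w\<close>, and with \<open>W \<le> r F\<close> also \<open>W/w\<close>, bounded on bounded intervals.\<close>

lemma cum_w_div_le_powr:
  assumes m: "m \<ge> 1" and r: "r > 0"
  shows "cum_w_div m r \<le> r powr m"
proof -
  have "r powr m / m - cum_w_div m r \<ge> 0"
  proof (rule nonneg_if_derivative_nonneg[where f="\<lambda>r. r powr m / m - cum_w_div m r"
        and f'="\<lambda>r. r powr (m - 1) - weight m r / r"])
    show "continuous_on {0..} (\<lambda>r. r powr m / m - cum_w_div m r)"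
      using m by (intro continuous_intros continuous_on_cum_w_div continuous_on_powr') auto
    fix s :: real assume s: "s > 0"
    have "((\<lambda>r. r powr m / m - cum_w_div m r) has_real_derivative m * s powr (m - 1) / m - weight m s / s) (at s)"
      using s by (intro DERIV_diff DERIV_cdivide has_real_derivative_powr cum_w_div_has_derivative[OF m])
    then show "((\<lambda>r. r powr m / m - cum_w_div m r) has_real_derivative s powr (m - 1) - weight m s / s) (at s)"
      using m by simp
    have "weight m s / s = s powr (m - 1) * exp (- s\<^sup>2 / 2)"
      using s by (simp add: weight_def powr_diff)
    also have "\<dots> \<le> s powr (m - 1)" by (intro mult_left_le) auto
    finally show "s powr (m - 1) - weight m s / s \<ge> 0" by simp
  qed (use r m in \<open>auto simp: primitives_at_0[OF m]\<close>)
  moreover have "r powr m / m \<le> r powr m" using m by (simp add: divide_le_eq mult_left_mono[of 1 m "r powr m", simplified])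
  ultimately show ?thesis by simp
qed

lemma powr_le_weight:
  assumes "0 < r" "r \<le> R"
  shows "r powr m \<le> exp (R\<^sup>2 / 2) * weight m r"
proof -
  have "exp (R\<^sup>2 / 2) * exp (- r\<^sup>2 / 2) \<ge> 1"
    using assms power_mono[of r R 2] by (simp flip: exp_add)
  then have "1 * r powr m \<le> (exp (R\<^sup>2 / 2) * exp (- r\<^sup>2 / 2)) * r powr m"
    by (intro mult_right_mono) auto
  then show ?thesis by (simp add: weight_def ac_simps)
qed

lemma weight_le_powr: "weight m r \<le> r powr m"
  by (simp add: weight_def mult_left_le)

text \<open>The difference of the two sides is \<open>(1 - 1/m) (g - s)\<^sup>2\<close>: this is where \<open>m \<ge> 1\<close> provides the concavity
  in \<open>g\<close>.\<close>

lemma concave_quadratic_bound: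
  fixes m g h s :: real
  assumes m: "m \<ge> 1"
  shows "(g + (m * h - s))\<^sup>2 / m - g\<^sup>2 \<le> h * (m * h - s) + (s - h) * s - 2 * (s - h) * g"
proof -
  have "h * (m * h - s) + (s - h) * s - 2 * (s - h) * g - ((g + (m * h - s))\<^sup>2 / m - g\<^sup>2)
      = (1 - 1 / m) * (g - s)\<^sup>2"
    using m by (simp add: power2_eq_square field_simps)
  also have "\<dots> \<ge> 0" using m by simp
  finally show ?thesis by simp
qed

lemma convex_quadratic_identity:
  fixes m t h s :: real
  assumes m: "m \<ge> 1"
  shows "(s + t)\<^sup>2 / m - s\<^sup>2 - 2 * (h * t) + h * (m * h - s) + (s - h) * s = (t - (m * h - s))\<^sup>2 / m"
proof -
  have "m \<noteq> 0" using m by simp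
  then show ?thesis by (simp add: power2_eq_square field_simps)
qed

text \<open>The following functions form the saddle point. The multiplier \<open>c\<close> is \<open>saddle_const\<close>, and the parameter \<open>b\<close>,
  which is the value of \<open>v\<close> at \<open>0\<close>, is \<open>saddle_b\<close>; it is chosen to make the flux vanish at \<open>R\<close>.\<close>

definition saddle_const :: "real \<Rightarrow> real \<Rightarrow> real" where
  "saddle_const m R = 1 / inv_gap m R"

definition saddle_b :: "real \<Rightarrow> real \<Rightarrow> real" where
  "saddle_b m R = - saddle_const m R * flux_alpha m R / flux_beta m R"

definition saddle_h :: "real \<Rightarrow> real \<Rightarrow> real \<Rightarrow> real" where
  "saddle_h m R r = (saddle_const m R * cum_w_div m r + saddle_b m R * cum_w m r) / weight m r"

definition saddle_g :: "real \<Rightarrow> real \<Rightarrow> real \<Rightarrow> real" where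
  "saddle_g m R r = saddle_const m R + saddle_h m R r"

definition saddle_v :: "real \<Rightarrow> real \<Rightarrow> real \<Rightarrow> real" where
  "saddle_v m R r = saddle_b m R + r * saddle_h m R r"

text \<open>The derivative of \<open>saddle_v m R\<close>, simplified with the first-order equation
  \<open>r h' = c + r b - (m - r\<^sup>2) h\<close>.\<close>

definition saddle_v' :: "real \<Rightarrow> real \<Rightarrow> real \<Rightarrow> real" where
  "saddle_v' m R r = saddle_h m R r + saddle_const m R + r * saddle_b m R - (m - r\<^sup>2) * saddle_h m R r"

definition saddle_flux :: "real \<Rightarrow> real \<Rightarrow> real \<Rightarrow> real" where
  "saddle_flux m R r = saddle_const m R * flux_alpha m r + saddle_b m R * flux_beta m r"

text \<open>The integrand of the first variation of \<open>\<Phi>\<close> at the saddle point in the direction \<open>v\<close>, up to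
  the factor \<open>2\<close>.\<close>

definition euler_lagrange :: "real \<Rightarrow> real \<Rightarrow> (real \<Rightarrow> real) \<Rightarrow> real \<Rightarrow> real" where
  "euler_lagrange m R v r = saddle_v' m R r * weak_deriv R v r + saddle_v m R r * v r + saddle_h m R r * T R v r"

definition Phi_integrand :: "real \<Rightarrow> real \<Rightarrow> (real \<Rightarrow> real) \<Rightarrow> (real \<Rightarrow> real) \<Rightarrow> real \<Rightarrow> real" where
  "Phi_integrand m R g v r = (weak_deriv R v r)\<^sup>2 + (v r)\<^sup>2 + (g r + T R v r)\<^sup>2 / m - (g r)\<^sup>2"

context
  fixes m R :: real
  assumes m: "m \<ge> 1" and R: "R > 0"
begin

lemma m0: "m > 0" using m by simp

lemma saddle_h_has_derivative:
  assumes r: "r > 0"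
  shows "(saddle_h m R has_real_derivative saddle_const m R / r + saddle_b m R - (m / r - r) * saddle_h m R r) (at r)"
proof -
  let ?n = "\<lambda>r. saddle_const m R * cum_w_div m r + saddle_b m R * cum_w m r"
  have w: "weight m r \<noteq> 0" using weight_pos[OF r, of m] by simp
  have "((\<lambda>r. ?n r / weight m r) has_real_derivative
      ((saddle_const m R * (weight m r / r) + saddle_b m R * weight m r) * weight m r - ?n r * ((m / r - r) * weight m r))
        / (weight m r * weight m r)) (at r)"
    using r w m0 by (intro DERIV_divide DERIV_add DERIV_cmult cum_w_div_has_derivative[OF m] cum_w_has_derivative
        weight_has_derivative)
  moreover have "((saddle_const m R * (weight m r / r) + saddle_b m R * weight m r) * weight m r - ?n r * ((m / r - r) * weight m r))
        / (weight m r * weight m r) = saddle_const m R / r + saddle_b m R - (m / r - r) * saddle_h m R r"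
    using r w by (simp add: saddle_h_def field_simps)
  ultimately show ?thesis unfolding saddle_h_def[abs_def] by simp
qed

lemma continuous_on_saddle_h: "continuous_on {0<..<R} (saddle_h m R)"
  by (intro continuous_at_imp_continuous_on ballI DERIV_isCont[OF saddle_h_has_derivative]) auto

lemma saddle_v_has_derivative:
  assumes r: "r > 0"
  shows "(saddle_v m R has_real_derivative saddle_v' m R r) (at r)"
proof -
  have "((\<lambda>r. saddle_b m R + r * saddle_h m R r) has_real_derivative
     0 + (1 * saddle_h m R r + (saddle_const m R / r + saddle_b m R - (m / r - r) * saddle_h m R r) * r)) (at r)"
    by (intro DERIV_add DERIV_const DERIV_mult DERIV_ident saddle_h_has_derivative r)
  moreover have "0 + (1 * saddle_h m R r + (saddle_const m R / r + saddle_b m R - (m / r - r) * saddle_h m R r) * r) = saddle_v' m R r"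
    using r by (simp add: saddle_v'_def field_simps power2_eq_square)
  ultimately show ?thesis unfolding saddle_v_def[abs_def] by simp
qed

lemma saddle_h_bounded: obtains B where "B \<ge> 0" "\<And>r. r \<in> {0<..<R} \<Longrightarrow> \<bar>saddle_h m R r\<bar> \<le> B"
proof -
  let ?E = "exp (R\<^sup>2 / 2)"
  have "\<bar>saddle_h m R r\<bar> \<le> \<bar>saddle_const m R\<bar> * ?E + \<bar>saddle_b m R\<bar> * (R * ?E)" if r: "r \<in> {0<..<R}" for r
  proof -
    have r0: "r > 0" "r \<le> R" using r by auto
    note w = weight_pos[OF r0(1), of m]
    have F: "cum_w_div m r \<le> ?E * weight m r"
      using cum_w_div_le_powr[OF m r0(1)] powr_le_weight[OF r0, of m] by simp
    have "cum_w m r \<le> r * cum_w_div m r" using cum2_w_div_pos[OF m r0(1)] by (simp add: cum2_w_div_def)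
    also have "\<dots> \<le> R * (?E * weight m r)" using F r0 cum_w_div_pos[OF m r0(1)] by (intro mult_mono) auto
    finally have W: "cum_w m r \<le> R * (?E * weight m r)" .
    have "\<bar>saddle_const m R * cum_w_div m r + saddle_b m R * cum_w m r\<bar> \<le> \<bar>saddle_const m R\<bar> * cum_w_div m r + \<bar>saddle_b m R\<bar> * cum_w m r"
      using cum_w_div_pos[OF m r0(1)] cum_w_pos[OF m r0(1)]
      by (intro order_trans[OF abs_triangle_ineq]) (simp add: abs_mult)
    also have "\<dots> \<le> \<bar>saddle_const m R\<bar> * (?E * weight m r) + \<bar>saddle_b m R\<bar> * (R * (?E * weight m r))"
      using F W by (intro add_mono mult_left_mono) auto
    also have "\<dots> = (\<bar>saddle_const m R\<bar> * ?E + \<bar>saddle_b m R\<bar> * (R * ?E)) * weight m r" by (simp add: algebra_simps)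
    finally show ?thesis using w by (simp add: saddle_h_def abs_divide divide_le_eq)
  qed
  moreover have "\<bar>saddle_const m R\<bar> * ?E + \<bar>saddle_b m R\<bar> * (R * ?E) \<ge> 0" using R by simp
  ultimately show ?thesis using that by blast
qed

lemma saddle_v_H1: "saddle_v m R \<in> H1 m R" "AE r in lebesgue_on {0<..<R}. weak_deriv R (saddle_v m R) r = saddle_v' m R r"
proof -
  obtain B where B: "B \<ge> 0" "\<And>r. r \<in> {0<..<R} \<Longrightarrow> \<bar>saddle_h m R r\<bar> \<le> B" using saddle_h_bounded by metis
  have 1: "\<bar>saddle_v m R r\<bar> \<le> \<bar>saddle_b m R\<bar> + R * B + (\<bar>saddle_const m R\<bar> + R * \<bar>saddle_b m R\<bar> + B + (m + R\<^sup>2) * B)"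
    and 2: "\<bar>saddle_v' m R r\<bar> \<le> \<bar>saddle_b m R\<bar> + R * B + (\<bar>saddle_const m R\<bar> + R * \<bar>saddle_b m R\<bar> + B + (m + R\<^sup>2) * B)"
    if r: "r \<in> {0<..<R}" for r
  proof -
    have r0: "0 < r" "r \<le> R" using r by auto
    have a: "\<bar>r * saddle_h m R r\<bar> \<le> R * B" unfolding abs_mult using B(2)[OF r] r0 by (intro mult_mono) auto
    have "0 \<le> r\<^sup>2" "r\<^sup>2 \<le> R\<^sup>2" using power_mono[OF r0(2), of 2] r0 by auto
    then have "\<bar>m - r\<^sup>2\<bar> \<le> m + R\<^sup>2" using m0 by linarith
    then have b: "\<bar>(m - r\<^sup>2) * saddle_h m R r\<bar> \<le> (m + R\<^sup>2) * B"
      unfolding abs_mult using B(2)[OF r] by (intro mult_mono) auto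
    have c: "\<bar>r * saddle_b m R\<bar> \<le> R * \<bar>saddle_b m R\<bar>" unfolding abs_mult using r0 by (intro mult_mono) auto
    have pos: "0 \<le> R * B" "0 \<le> (m + R\<^sup>2) * B" "0 \<le> R * \<bar>saddle_b m R\<bar>" using R m0 B(1) by auto
    show "\<bar>saddle_v m R r\<bar> \<le> \<bar>saddle_b m R\<bar> + R * B + (\<bar>saddle_const m R\<bar> + R * \<bar>saddle_b m R\<bar> + B + (m + R\<^sup>2) * B)"
      unfolding saddle_v_def using a pos B(1) abs_triangle_ineq[of "saddle_b m R" "r * saddle_h m R r"] by linarith
    show "\<bar>saddle_v' m R r\<bar> \<le> \<bar>saddle_b m R\<bar> + R * B + (\<bar>saddle_const m R\<bar> + R * \<bar>saddle_b m R\<bar> + B + (m + R\<^sup>2) * B)"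
      unfolding saddle_v'_def using b c pos B(2)[OF r] by linarith
  qed
  have cont: "continuous_on {0<..<R} (saddle_v' m R)"
    unfolding saddle_v'_def[abs_def] by (intro continuous_intros continuous_on_saddle_h)
  show "saddle_v m R \<in> H1 m R" "AE r in lebesgue_on {0<..<R}. weak_deriv R (saddle_v m R) r = saddle_v' m R r"
    using H1_classical[OF m0 saddle_v_has_derivative cont 1 2] by auto
qed

lemma saddle_h_L2: "saddle_h m R \<in> L2 m R"
proof -
  obtain B where B: "B \<ge> 0" "\<And>r. r \<in> {0<..<R} \<Longrightarrow> \<bar>saddle_h m R r\<bar> \<le> B" using saddle_h_bounded by metis
  show ?thesis
    by (rule L2_bounded[OF m0 _ B(2)]) (auto intro: continuous_imp_measurable_on_sets_lebesgue continuous_on_saddle_h)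
qed

lemma saddle_g_L2: "saddle_g m R \<in> L2 m R"
  unfolding saddle_g_def[abs_def] by (intro L2_add L2_const saddle_h_L2 m0)

lemma saddle_flux_has_derivative:
  assumes r: "r > 0"
  shows "(saddle_flux m R has_real_derivative weight m r * (saddle_v m R r + r * saddle_h m R r)) (at r)"
proof -
  have w: "weight m r \<noteq> 0" using weight_pos[OF r, of m] by simp
  have "((\<lambda>r. saddle_const m R * (cum2_w m r + r * cum2_w_div m r) + saddle_b m R * flux_beta m r) has_real_derivative
     saddle_const m R * (cum_w m r + (1 * cum2_w_div m r + cum_w_div m r * r)) +
     saddle_b m R * (cum2_w m r + r * cum_w m r + m * cum_w_div m r)) (at r)"
    by (intro DERIV_add DERIV_cmult DERIV_mult DERIV_ident cum2_w_has_derivative[OF m] cum2_w_div_has_derivative[OF m]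
        flux_beta_has_derivative[OF m] r)
  moreover have "saddle_const m R * (cum_w m r + (1 * cum2_w_div m r + cum_w_div m r * r)) +
     saddle_b m R * (cum2_w m r + r * cum_w m r + m * cum_w_div m r) = weight m r * (saddle_v m R r + r * saddle_h m R r)"
  proof -
    have h: "weight m r * saddle_h m R r = saddle_const m R * cum_w_div m r + saddle_b m R * cum_w m r"
      using w by (simp add: saddle_h_def)
    have "weight m r * (saddle_v m R r + r * saddle_h m R r) = weight m r * saddle_b m R + 2 * r * (weight m r * saddle_h m R r)"
      by (simp add: saddle_v_def algebra_simps)
    also have "\<dots> = weight m r * saddle_b m R + 2 * r * (saddle_const m R * cum_w_div m r + saddle_b m R * cum_w m r)"
      by (simp only: h)
    finally show ?thesis by (simp add: weight_eq[OF m] cum2_w_div_def[of m r] algebra_simps)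
  qed
  ultimately show ?thesis
    unfolding saddle_flux_def[abs_def] flux_alpha_def by simp
qed

lemma saddle_flux_eq:
  assumes r: "r > 0"
  shows "saddle_flux m R r = weight m r * (saddle_v' m R r - saddle_h m R r)"
proof -
  have w: "weight m r \<noteq> 0" using weight_pos[OF r, of m] by simp
  have h: "weight m r * saddle_h m R r = saddle_const m R * cum_w_div m r + saddle_b m R * cum_w m r"
    using w by (simp add: saddle_h_def)
  have "weight m r * (saddle_v' m R r - saddle_h m R r)
      = weight m r * (saddle_const m R + r * saddle_b m R) - (m - r\<^sup>2) * (weight m r * saddle_h m R r)"
    by (simp add: saddle_v'_def algebra_simps)
  also have "\<dots> = weight m r * (saddle_const m R + r * saddle_b m R) - (m - r\<^sup>2) * (saddle_const m R * cum_w_div m r + saddle_b m R * cum_w m r)"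
    by (simp only: h)
  also have "\<dots> = saddle_flux m R r"
    unfolding weight_eq[OF m] saddle_flux_def flux_alpha_def flux_beta_def cum2_w_div_def
    by (simp add: power2_eq_square algebra_simps)
  finally show ?thesis by simp
qed

lemma saddle_flux_0: "saddle_flux m R 0 = 0"
  by (simp add: saddle_flux_def flux_alpha_def flux_beta_def primitives_at_0[OF m])

lemma saddle_flux_R: "saddle_flux m R R = 0"
  using flux_beta_pos[OF m R] by (simp add: saddle_flux_def saddle_b_def)

lemma continuous_on_saddle_flux: "continuous_on {0..} (saddle_flux m R)"
  unfolding saddle_flux_def[abs_def] flux_alpha_def flux_beta_def
  by (intro continuous_intros continuous_on_cum2_w continuous_on_cum2_w_div m)

lemma smooth_upto_saddle_flux: "smooth_upto k {0<..<R} (saddle_flux m R)"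
proof -
  have W: "smooth_upto k {0<..} (cum_w m)" "smooth_upto k {0<..} (cum_w (m + 1))"
    using m0 by (auto intro: smooth_upto_cum_w)
  have F: "smooth_upto k {0<..} (cum_w_div m)"
    unfolding cum_w_div_def[abs_def]
    by (intro smooth_upto_divide smooth_upto_add smooth_upto_weight W smooth_upto_const open_greaterThan)
       (use m0 in auto)
  have I: "smooth_upto k {0<..} (cum2_w m)" and K: "smooth_upto k {0<..} (cum2_w_div m)"
    unfolding cum2_w_def[abs_def] cum2_w_div_def[abs_def]
    by (intro smooth_upto_diff smooth_upto_mult smooth_upto_ident W F open_greaterThan)+
  have "smooth_upto k {0<..} (saddle_flux m R)"
    unfolding saddle_flux_def[abs_def] flux_alpha_def flux_beta_def
    by (intro smooth_upto_add smooth_upto_mult smooth_upto_ident smooth_upto_const I K open_greaterThan)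
  then show ?thesis by (rule smooth_upto_subset) auto
qed

text \<open>The mean value theorem from either end: near \<open>0\<close> the derivative is at most a multiple of \<open>w\<close>, which is
  comparable to a power of \<open>r\<close>; near \<open>R\<close> it is bounded, and \<open>r w\<close> is bounded below on \<open>[R/2,R]\<close>.\<close>

lemma saddle_flux_bounds:
  obtains C where "\<And>r. r \<in> {0<..<R} \<Longrightarrow> \<bar>saddle_flux m R r\<bar> \<le> C * (r * (R - r)) * weight m r"
    "\<And>r. r \<in> {0<..<R} \<Longrightarrow> \<bar>deriv (saddle_flux m R) r\<bar> \<le> C * weight m r"
proof -
  obtain B where B: "B \<ge> 0" "\<And>r. r \<in> {0<..<R} \<Longrightarrow> \<bar>saddle_h m R r\<bar> \<le> B" using saddle_h_bounded by metis
  define q' where "q' = (\<lambda>r. weight m r * (saddle_v m R r + r * saddle_h m R r))"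
  define M where "M = \<bar>saddle_b m R\<bar> + 2 * (R * B)"
  have M: "M \<ge> 0" using B R by (simp add: M_def)
  have q': "\<bar>q' r\<bar> \<le> M * weight m r" if r: "r \<in> {0<..<R}" for r
  proof -
    have "\<bar>r * saddle_h m R r\<bar> \<le> R * B" unfolding abs_mult using B(2)[OF r] r by (intro mult_mono) auto
    then have "\<bar>saddle_v m R r + r * saddle_h m R r\<bar> \<le> M" unfolding saddle_v_def M_def by linarith
    from mult_right_mono[OF this weight_nonneg[of m r]] show ?thesis
      by (simp add: q'_def abs_mult weight_nonneg mult.commute)
  qed
  have der: "(saddle_flux m R has_real_derivative q' r) (at r)" if "r > 0" for r
    unfolding q'_def by (rule saddle_flux_has_derivative[OF that])
  let ?E = "exp (R\<^sup>2 / 2)"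
  define k where "k = (R / 2) * (R / 2) powr m"
  have k: "k > 0" using R by (simp add: k_def)
  \<comment> \<open>The summands serve the bound on the derivative, the left half and the right half of the interval.\<close>
  define C where "C = M + 2 * M * ?E / R + M * R powr m * ?E / k"
  have pos: "2 * M * ?E / R \<ge> 0" "M * R powr m * ?E / k \<ge> 0" using M R k by auto
  have "\<bar>saddle_flux m R r\<bar> \<le> C * (r * (R - r)) * weight m r" if r: "r \<in> {0<..<R}" for r
  proof -
    have r0: "0 < r" "r < R" using r by auto
    have X: "0 \<le> r * (R - r) * weight m r" using r0 by (simp add: weight_nonneg)
    have mvt: "\<exists>z. s < z \<and> z < t \<and> saddle_flux m R t - saddle_flux m R s = (t - s) * q' z" if "0 \<le> s" and st: "s < t" for s t
    proof -
      have "continuous_on {s..t} (saddle_flux m R)" by (rule continuous_on_subset[OF continuous_on_saddle_flux]) (use that in auto)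
      moreover have "saddle_flux m R differentiable (at x)" if "s < x" for x
        using der[of x] \<open>0 \<le> s\<close> that unfolding real_differentiable_def by (intro exI) auto
      ultimately obtain l z where z: "s < z" "z < t" "DERIV (saddle_flux m R) z :> l"
          "saddle_flux m R t - saddle_flux m R s = (t - s) * l"
        using MVT[OF st, of "saddle_flux m R"] by blast
      have "l = q' z" using DERIV_unique[OF z(3) der[of z]] z(1) \<open>0 \<le> s\<close> by simp
      with z show ?thesis by blast
    qed
    show ?thesis
    proof (cases "r \<le> R / 2")
      case True
      obtain z where z: "0 < z" "z < r" "saddle_flux m R r = r * q' z" using mvt[of 0 r] r0 saddle_flux_0 by auto
      have "\<bar>q' z\<bar> \<le> M * weight m z" using q' z r0 by auto
      also have "\<dots> \<le> M * r powr m"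
        using M z m0 order_trans[OF weight_le_powr[of m z] powr_mono2[of m z r]] by (intro mult_left_mono) auto
      also have "\<dots> \<le> M * (?E * weight m r)"
        using M powr_le_weight[of r R m] r0 by (intro mult_left_mono) auto
      finally have "\<bar>saddle_flux m R r\<bar> \<le> r * (M * (?E * weight m r))"
        unfolding z(3) abs_mult using r0 by (simp add: mult_left_mono)
      also have "\<dots> = 1 * (r * (M * (?E * weight m r)))" by simp
      also have "\<dots> \<le> (2 / R * (R - r)) * (r * (M * (?E * weight m r)))"
        using True R M r0 by (intro mult_right_mono) (auto simp: field_simps weight_nonneg)
      also have "\<dots> = (2 * M * ?E / R) * (r * (R - r) * weight m r)" by simp
      also have "\<dots> \<le> C * (r * (R - r) * weight m r)"
        using pos M X by (intro mult_right_mono) (auto simp: C_def)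
      finally show ?thesis by (simp add: mult.assoc)
    next
      case False
      obtain z where z: "r < z" "z < R" "- saddle_flux m R r = (R - r) * q' z" using mvt[of r R] r0 saddle_flux_R by auto
      have "\<bar>q' z\<bar> \<le> M * weight m z" using q' z r0 by auto
      also have "\<dots> \<le> M * R powr m"
        using M z r0 m0 order_trans[OF weight_le_powr[of m z] powr_mono2[of m z R]] by (intro mult_left_mono) auto
      finally have "\<bar>saddle_flux m R r\<bar> \<le> (R - r) * (M * R powr m)"
        using z(3) r0 by (metis abs_minus_cancel abs_mult abs_of_pos diff_gt_0_iff_gt mult_left_mono less_imp_le)
      also have "\<dots> = (R - r) * (M * R powr m) * 1" by simp
      also have "\<dots> \<le> (R - r) * (M * R powr m) * (r * (?E * weight m r) / k)"
      proof (intro mult_left_mono)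
        have "k \<le> r * r powr m"
          unfolding k_def using False R m0 by (intro mult_mono powr_mono2) auto
        also have "\<dots> \<le> r * (?E * weight m r)"
          using powr_le_weight[of r R m] r0 by (intro mult_left_mono) auto
        finally show "1 \<le> r * (?E * weight m r) / k" using k by (simp add: le_divide_eq)
      qed (use r0 M in auto)
      also have "\<dots> = (M * R powr m * ?E / k) * (r * (R - r) * weight m r)" by (simp add: ac_simps)
      also have "\<dots> \<le> C * (r * (R - r) * weight m r)"
        using pos M X by (intro mult_right_mono) (auto simp: C_def)
      finally show ?thesis by (simp add: mult.assoc)
    qed
  qed
  moreover have "\<bar>deriv (saddle_flux m R) r\<bar> \<le> C * weight m r" if r: "r \<in> {0<..<R}" for r
  proof -
    have "deriv (saddle_flux m R) r = q' r" using der r by (intro DERIV_imp_deriv) auto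
    moreover have "M * weight m r \<le> C * weight m r"
      using pos by (intro mult_right_mono) (auto simp: C_def weight_nonneg)
    ultimately show ?thesis using q'[OF r] by simp
  qed
  ultimately show ?thesis using that by blast
qed

lemma saddle_v'_L2: "saddle_v' m R \<in> L2 m R"
proof (rule L2_cong_AE[OF H1_L2(3)[OF saddle_v_H1(1)]])
  have "continuous_on {0<..<R} (saddle_v' m R)"
    unfolding saddle_v'_def[abs_def] by (intro continuous_intros continuous_on_saddle_h)
  then show "saddle_v' m R \<in> borel_measurable (lebesgue_on {0<..<R})"
    by (intro continuous_imp_measurable_on_sets_lebesgue) auto
  show "AE r in lebesgue_on {0<..<R}. saddle_v' m R r = weak_deriv R (saddle_v m R) r"
    using saddle_v_H1(2) by eventually_elim simp
qed

text \<open>By \<open>q = w (v' - h)\<close> and \<open>q' = w (v + r h)\<close> for the saddle point, the integrand is \<open>q\<close> times the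
  derivative of the direction plus \<open>q'\<close> times the direction.\<close>

lemma euler_lagrange_integral:
  assumes v: "v \<in> H1 m R"
  shows "integrable (lebesgue_on {0<..<R}) (\<lambda>r. euler_lagrange m R v r * weight m r)"
    "(\<integral>r. euler_lagrange m R v r * weight m r \<partial>lebesgue_on {0<..<R}) = 0"
proof -
  have "integrable (lebesgue_on {0<..<R}) (\<lambda>r. saddle_v' m R r * weak_deriv R v r * weight m r
     + saddle_v m R r * v r * weight m r + saddle_h m R r * T R v r * weight m r)"
    by (intro Bochner_Integration.integrable_add L2_mult_integrable saddle_v'_L2 saddle_h_L2 H1_L2[OF v] H1_L2(2)[OF saddle_v_H1(1)])
  then show "integrable (lebesgue_on {0<..<R}) (\<lambda>r. euler_lagrange m R v r * weight m r)"
    by (simp add: euler_lagrange_def distrib_right)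
  obtain C where C: "\<And>r. r \<in> {0<..<R} \<Longrightarrow> \<bar>saddle_flux m R r\<bar> \<le> C * (r * (R - r)) * weight m r"
    "\<And>r. r \<in> {0<..<R} \<Longrightarrow> \<bar>deriv (saddle_flux m R) r\<bar> \<le> C * weight m r" using saddle_flux_bounds by metis
  have "(\<integral>r. euler_lagrange m R v r * weight m r \<partial>lebesgue_on {0<..<R})
     = (\<integral>r. weak_deriv R v r * saddle_flux m R r + v r * deriv (saddle_flux m R) r \<partial>lebesgue_on {0<..<R})"
  proof (rule Bochner_Integration.integral_cong)
    fix r assume "r \<in> space (lebesgue_on {0<..<R})"
    then have r: "r > 0" by simp
    have "deriv (saddle_flux m R) r = weight m r * (saddle_v m R r + r * saddle_h m R r)"
      by (rule DERIV_imp_deriv[OF saddle_flux_has_derivative[OF r]])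
    then show "euler_lagrange m R v r * weight m r = weak_deriv R v r * saddle_flux m R r + v r * deriv (saddle_flux m R) r"
      by (simp add: euler_lagrange_def T_def saddle_flux_eq[OF r] algebra_simps)
  qed simp
  also have "\<dots> = 0" by (rule H1_integral_by_parts[OF m0 R v smooth_upto_saddle_flux C])
  finally show "(\<integral>r. euler_lagrange m R v r * weight m r \<partial>lebesgue_on {0<..<R}) = 0" .
qed

text \<open>Stationarity with respect to \<open>g\<close>.\<close>

lemma T_saddle_v:
  assumes "weak_deriv R (saddle_v m R) r = saddle_v' m R r"
  shows "T R (saddle_v m R) r = m * saddle_h m R r - saddle_g m R r"
  by (simp add: T_def assms saddle_v_def saddle_v'_def saddle_g_def power2_eq_square algebra_simps)

lemma integral_saddle_h: "(\<integral>r. saddle_h m R r * weight m r \<partial>lebesgue_on {0<..<R}) = saddle_const m R * cum2_w_div m R + saddle_b m R * cum2_w m R"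
proof -
  let ?f = "\<lambda>r. saddle_const m R * cum_w_div m r + saddle_b m R * cum_w m r"
  have "(\<integral>r. saddle_h m R r * weight m r \<partial>lebesgue_on {0<..<R}) = (\<integral>r. ?f r \<partial>lebesgue_on {0<..<R})"
  proof (rule Bochner_Integration.integral_cong)
    fix r assume "r \<in> space (lebesgue_on {0<..<R})"
    then show "saddle_h m R r * weight m r = ?f r" using weight_pos[of r m] by (simp add: saddle_h_def)
  qed simp
  also have "\<dots> = integral {0..R} ?f"
    by (rule continuous_integrable_open_interval, rule continuous_on_subset[of "{0..}"])
       (auto intro!: continuous_intros continuous_on_cum_w_div continuous_on_cum_w m m0)
  also have "(?f has_integral (saddle_const m R * cum2_w_div m R + saddle_b m R * cum2_w m R) - (saddle_const m R * cum2_w_div m 0 + saddle_b m R * cum2_w m 0)) {0..R}"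
  proof (rule fundamental_theorem_of_calculus_interior)
    show "continuous_on {0..R} (\<lambda>r. saddle_const m R * cum2_w_div m r + saddle_b m R * cum2_w m r)"
      by (rule continuous_on_subset[of "{0..}"])
         (auto intro!: continuous_intros continuous_on_cum2_w_div continuous_on_cum2_w m)
    fix x assume "x \<in> {0<..<R}"
    then show "((\<lambda>r. saddle_const m R * cum2_w_div m r + saddle_b m R * cum2_w m r) has_vector_derivative ?f x) (at x)"
      unfolding has_real_derivative_iff_has_vector_derivative[symmetric]
      by (intro DERIV_add DERIV_cmult cum2_w_div_has_derivative[OF m] cum2_w_has_derivative[OF m]) auto
  qed (use R in simp)
  then have "integral {0..R} ?f = saddle_const m R * cum2_w_div m R + saddle_b m R * cum2_w m R"
    by (simp add: integral_unique primitives_at_0[OF m])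
  finally show ?thesis .
qed

lemma W_pos: "cum_w m R > 0" by (rule cum_w_pos[OF m R])

lemmas expect_eq' = expect_eq[OF m0 W_pos]

text \<open>The multiplier is defined so that this holds: \<open>c\<close> times \<open>W + K + (b/c) I\<close> is \<open>W\<close>, because
  \<open>\<beta> K - \<alpha> I = m K\<^sup>2 - I\<^sup>2\<close>.\<close>

lemma integral_saddle_g: "(\<integral>r. saddle_g m R r * weight m r \<partial>lebesgue_on {0<..<R}) = cum_w m R"
proof -
  have "(\<integral>r. saddle_g m R r * weight m r \<partial>lebesgue_on {0<..<R})
     = (\<integral>r. saddle_const m R * weight m r + saddle_h m R r * weight m r \<partial>lebesgue_on {0<..<R})"
    by (simp add: saddle_g_def distrib_right)
  also have "\<dots> = saddle_const m R * cum_w m R + (saddle_const m R * cum2_w_div m R + saddle_b m R * cum2_w m R)"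
    using integral_saddle_h integrable_weight[OF m0, of R] L2_integrable[OF m0 saddle_h_L2] by simp
  also have "\<dots> = cum_w m R"
  proof -
    have b: "flux_beta m R \<noteq> 0" and W: "cum_w m R \<noteq> 0" and inv_gap: "inv_gap m R \<noteq> 0"
      using flux_beta_pos[OF m R] W_pos inv_gap_ge_1[OF m R] by auto
    have P: "sq_diff m R = flux_beta m R * cum2_w_div m R - flux_alpha m R * cum2_w m R"
      by (simp add: sq_diff_def flux_beta_def flux_alpha_def power2_eq_square algebra_simps)
    have "inv_gap m R * (cum_w m R * flux_beta m R) = cum_w m R * flux_beta m R + sq_diff m R"
      using b W by (simp add: inv_gap_def field_simps)
    then have r: "inv_gap m R * (cum_w m R * flux_beta m R) = cum_w m R * flux_beta m R + flux_beta m R * cum2_w_div m R - flux_alpha m R * cum2_w m R"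
      unfolding P by simp
    have "saddle_const m R * cum_w m R + (saddle_const m R * cum2_w_div m R + saddle_b m R * cum2_w m R)
        = saddle_const m R * (cum_w m R * flux_beta m R + flux_beta m R * cum2_w_div m R - flux_alpha m R * cum2_w m R) / flux_beta m R"
      using b by (simp add: saddle_b_def field_simps)
    also have "\<dots> = cum_w m R" unfolding r[symmetric] using b inv_gap by (simp add: saddle_const_def)
    finally show ?thesis .
  qed
  finally show ?thesis .
qed

lemma saddle_g_admissible: "saddle_g m R \<in> admissible m R"
  using saddle_g_L2 integral_saddle_g W_pos by (simp add: admissible_def expect_eq' L2_measurable)

section \<open>The value at the saddle point\<close>

lemma admissible_integral:
  assumes g: "g \<in> admissible m R"
  shows "g \<in> L2 m R" "(\<integral>r. g r * weight m r \<partial>lebesgue_on {0<..<R}) = cum_w m R"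
proof -
  show L: "g \<in> L2 m R" using g by (simp add: admissible_def)
  have "expect m R g = 1" using g by (simp add: admissible_def)
  then show "(\<integral>r. g r * weight m r \<partial>lebesgue_on {0<..<R}) = cum_w m R"
    using W_pos by (simp add: expect_eq'[OF L2_measurable[OF L]])
qed

lemma Phi_eq:
  assumes g: "g \<in> admissible m R" and v: "v \<in> H1 m R"
  shows "integrable (lebesgue_on {0<..<R}) (\<lambda>r. Phi_integrand m R g v r * weight m r)"
    "Phi m R g v = (\<integral>r. Phi_integrand m R g v r * weight m r \<partial>lebesgue_on {0<..<R}) / cum_w m R + 1"
proof -
  let ?M = "lebesgue_on {0<..<R}"
  note gL = admissible_integral[OF g]
  let ?A = "\<lambda>r. (weak_deriv R v r)\<^sup>2 + (v r)\<^sup>2 + (g r + T R v r)\<^sup>2 / m"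
  have sq_int: "integrable ?M (\<lambda>r. (f r)\<^sup>2 * weight m r)" if "f \<in> L2 m R" for f
    using that by (simp add: L2_def)
  have gT: "(\<lambda>r. g r + T R v r) \<in> L2 m R" by (intro L2_add gL H1_L2[OF v])
  have "integrable ?M (\<lambda>r. (weak_deriv R v r)\<^sup>2 * weight m r + (v r)\<^sup>2 * weight m r + (g r + T R v r)\<^sup>2 * weight m r / m)"
    by (intro Bochner_Integration.integrable_add integrable_divide sq_int gT H1_L2[OF v])
  then have A: "integrable ?M (\<lambda>r. ?A r * weight m r)" by (simp add: distrib_right)
  have G: "integrable ?M (\<lambda>r. (g r)\<^sup>2 * weight m r)" by (rule sq_int[OF gL(1)])
  show "integrable ?M (\<lambda>r. Phi_integrand m R g v r * weight m r)"
    using Bochner_Integration.integrable_diff[OF A G] by (simp add: Phi_integrand_def algebra_simps)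
  have gm: "g \<in> borel_measurable ?M" by (rule L2_measurable[OF gL(1)])
  have "expect m R ?A = (\<integral>r. ?A r * weight m r \<partial>?M) / cum_w m R"
    by (intro expect_eq' borel_measurable_add borel_measurable_power borel_measurable_divide borel_measurable_const
        L2_measurable[OF H1_L2(2)[OF v]] L2_measurable[OF H1_L2(3)[OF v]] L2_measurable[OF H1_L2(4)[OF v]] gm)
  moreover have "var m R g = (\<integral>r. (g r)\<^sup>2 * weight m r \<partial>?M) / cum_w m R - 1"
  proof -
    have "expect m R g = 1" using g by (simp add: admissible_def)
    then have "var m R g = expect m R (\<lambda>r. (g r - 1)\<^sup>2)" by (simp add: var_def)
    also have "\<dots> = (\<integral>r. (g r - 1)\<^sup>2 * weight m r \<partial>?M) / cum_w m R"
      by (intro expect_eq' borel_measurable_power borel_measurable_diff gm borel_measurable_const)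
    also have "(\<integral>r. (g r - 1)\<^sup>2 * weight m r \<partial>?M)
       = (\<integral>r. (g r)\<^sup>2 * weight m r - 2 * (g r * weight m r) + weight m r \<partial>?M)"
      by (simp add: power2_eq_square algebra_simps)
    also have "\<dots> = (\<integral>r. (g r)\<^sup>2 * weight m r \<partial>?M) - 2 * cum_w m R + cum_w m R"
      using G L2_integrable[OF m0 gL(1)] integrable_weight[OF m0, of R] gL(2) by simp
    finally show ?thesis using W_pos by (simp add: field_simps)
  qed
  moreover have "(\<integral>r. Phi_integrand m R g v r * weight m r \<partial>?M)
      = (\<integral>r. ?A r * weight m r \<partial>?M) - (\<integral>r. (g r)\<^sup>2 * weight m r \<partial>?M)"
    using Bochner_Integration.integral_diff[OF A G] by (simp add: Phi_integrand_def algebra_simps)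
  ultimately show "Phi m R g v = (\<integral>r. Phi_integrand m R g v r * weight m r \<partial>?M) / cum_w m R + 1"
    unfolding Phi_def by (simp add: diff_divide_distrib)
qed

text \<open>The integrand is concave in \<open>g\<close>, so it lies below its tangent at \<open>saddle_g\<close>; the tangent is the first
  variation in the direction \<open>saddle_v\<close>, which integrates to zero, plus an affine function of \<open>g\<close> whose
  integral is fixed by the constraint.\<close>

lemma Phi_saddle_v_le:
  assumes g: "g \<in> admissible m R"
  shows "Phi m R g (saddle_v m R) \<le> 1 - saddle_const m R"
proof -
  let ?M = "lebesgue_on {0<..<R}"
  let ?Y = "\<lambda>r. euler_lagrange m R (saddle_v m R) r * weight m r + saddle_const m R * (saddle_g m R r * weight m r) - 2 * saddle_const m R * (g r * weight m r)"
  note gL = admissible_integral[OF g]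
  note e = euler_lagrange_integral[OF saddle_v_H1(1)]
  note i = L2_integrable[OF m0 gL(1)] L2_integrable[OF m0 saddle_g_L2]
  have Y: "integrable ?M ?Y"
    by (intro Bochner_Integration.integrable_diff Bochner_Integration.integrable_add integrable_mult_right e i)
  have "(\<integral>r. ?Y r \<partial>?M) = - saddle_const m R * cum_w m R"
    using e i gL(2) integral_saddle_g by simp
  moreover have "(\<integral>r. Phi_integrand m R g (saddle_v m R) r * weight m r \<partial>?M) \<le> (\<integral>r. ?Y r \<partial>?M)"
  proof (rule integral_mono_AE[OF Phi_eq(1)[OF g saddle_v_H1(1)] Y])
    show "AE r in ?M. Phi_integrand m R g (saddle_v m R) r * weight m r \<le> ?Y r"
      using saddle_v_H1(2)
    proof eventually_elim
      case (elim r)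
      have sc: "saddle_const m R = saddle_g m R r - saddle_h m R r" by (simp add: saddle_g_def)
      have "Phi_integrand m R g (saddle_v m R) r \<le> euler_lagrange m R (saddle_v m R) r + saddle_const m R * saddle_g m R r - 2 * saddle_const m R * g r"
        unfolding Phi_integrand_def euler_lagrange_def T_saddle_v[OF elim] elim sc
        using concave_quadratic_bound[OF m, of "g r" "saddle_h m R r" "saddle_g m R r"]
        unfolding power2_eq_square[of "saddle_v' m R r"] power2_eq_square[of "saddle_v m R r"] by linarith
      from mult_right_mono[OF this weight_nonneg[of m r]] show ?case by (simp add: algebra_simps)
    qed
  qed
  ultimately have "(\<integral>r. Phi_integrand m R g (saddle_v m R) r * weight m r \<partial>?M) / cum_w m R \<le> - saddle_const m R"
    using W_pos by (simp add: divide_le_eq)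
  then show ?thesis unfolding Phi_eq(2)[OF g saddle_v_H1(1)] by simp
qed

text \<open>The integrand is convex in \<open>v\<close>: it exceeds its tangent at \<open>saddle_v\<close> by a sum of three squares. The tangent
  consists of first variations, which integrate to zero, and of \<open>- c g\<close>.\<close>

lemma Phi_saddle_g_ge:
  assumes v: "v \<in> H1 m R"
  shows "Phi m R (saddle_g m R) v \<ge> 1 - saddle_const m R"
proof -
  let ?M = "lebesgue_on {0<..<R}"
  let ?Y = "\<lambda>r. 2 * (euler_lagrange m R v r * weight m r) - euler_lagrange m R (saddle_v m R) r * weight m r - saddle_const m R * (saddle_g m R r * weight m r)"
  note e = euler_lagrange_integral[OF saddle_v_H1(1)] euler_lagrange_integral[OF v] L2_integrable[OF m0 saddle_g_L2]
  have Y: "integrable ?M ?Y"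
    by (intro Bochner_Integration.integrable_diff integrable_mult_right e)
  have "(\<integral>r. ?Y r \<partial>?M) = - saddle_const m R * cum_w m R"
    using e integral_saddle_g by simp
  moreover have "(\<integral>r. ?Y r \<partial>?M) \<le> (\<integral>r. Phi_integrand m R (saddle_g m R) v r * weight m r \<partial>?M)"
  proof (rule integral_mono_AE[OF Y Phi_eq(1)[OF saddle_g_admissible v]])
    show "AE r in ?M. ?Y r \<le> Phi_integrand m R (saddle_g m R) v r * weight m r"
      using saddle_v_H1(2)
    proof eventually_elim
      case (elim r)
      let ?h = "saddle_h m R r" and ?s = "saddle_g m R r" and ?t = "T R v r" and ?d = "weak_deriv R v r"
      let ?u = "m * ?h - ?s"
      have sc: "saddle_const m R = ?s - ?h" by (simp add: saddle_g_def)
      have "Phi_integrand m R (saddle_g m R) v r - (2 * euler_lagrange m R v r - euler_lagrange m R (saddle_v m R) r - saddle_const m R * ?s)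
         = (?d - saddle_v' m R r)\<^sup>2 + (v r - saddle_v m R r)\<^sup>2 + (?t - ?u)\<^sup>2 / m"
        unfolding Phi_integrand_def euler_lagrange_def T_saddle_v[OF elim] elim sc convex_quadratic_identity[OF m, symmetric]
        by (simp add: power2_diff) (simp add: power2_eq_square algebra_simps)
      also have "\<dots> \<ge> 0" using m0 by simp
      finally have "2 * euler_lagrange m R v r - euler_lagrange m R (saddle_v m R) r - saddle_const m R * ?s \<le> Phi_integrand m R (saddle_g m R) v r" by simp
      from mult_right_mono[OF this weight_nonneg[of m r]] show ?case by (simp add: algebra_simps)
    qed
  qed
  ultimately have "- saddle_const m R \<le> (\<integral>r. Phi_integrand m R (saddle_g m R) v r * weight m r \<partial>?M) / cum_w m R"
    using W_pos by (simp add: le_divide_eq)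
  then show ?thesis unfolding Phi_eq(2)[OF saddle_g_admissible v] by simp
qed

lemma inf_Phi_saddle_g: "inf_Phi m R (saddle_g m R) = ereal (1 - 1 / inv_gap m R)"
  unfolding inf_Phi_def
proof (rule antisym)
  show "(INF v\<in>H1 m R. ereal (Phi m R (saddle_g m R) v)) \<le> ereal (1 - 1 / inv_gap m R)"
    using Phi_saddle_v_le[OF saddle_g_admissible] by (intro INF_lower2[OF saddle_v_H1(1)]) (simp add: saddle_const_def)
  show "ereal (1 - 1 / inv_gap m R) \<le> (INF v\<in>H1 m R. ereal (Phi m R (saddle_g m R) v))"
    using Phi_saddle_g_ge by (intro INF_greatest) (simp add: saddle_const_def)
qed

lemma lambda_eq: "lambda m R = ereal (1 - 1 / inv_gap m R)"
  unfolding lambda_def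
proof (rule antisym)
  show "(SUP g\<in>admissible m R. inf_Phi m R g) \<le> ereal (1 - 1 / inv_gap m R)"
  proof (rule SUP_least)
    fix g assume "g \<in> admissible m R"
    from Phi_saddle_v_le[OF this] show "inf_Phi m R g \<le> ereal (1 - 1 / inv_gap m R)"
      unfolding inf_Phi_def by (intro INF_lower2[OF saddle_v_H1(1)]) (simp add: saddle_const_def)
  qed
  show "ereal (1 - 1 / inv_gap m R) \<le> (SUP g\<in>admissible m R. inf_Phi m R g)"
    unfolding inf_Phi_saddle_g[symmetric] by (rule SUP_upper[OF saddle_g_admissible])
qed

end

theorem theorem5p1:
  fixes m :: real
  assumes "m \<ge> 1"
  shows "(\<forall>R>0. lambda m R \<ge> ereal (kappa m)) \<and>
    ((\<lambda>R. lambda m R) \<longlongrightarrow> ereal (kappa m)) at_top \<and>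
    (\<forall>R>0. \<exists>g\<in>admissible m R. inf_Phi m R g = lambda m R)"
proof (intro conjI allI impI)
  note lim = inv_gap_tendsto[OF assms]
  fix R :: real assume R: "R > 0"
  show "lambda m R \<ge> ereal (kappa m)"
  proof -
    have "1 / (1 - kappa m) \<le> inv_gap m R"
    proof (rule tendsto_upperbound[OF lim(1)])
      show "\<forall>\<^sub>F s in at_top. inv_gap m s \<le> inv_gap m R"
        using eventually_ge_at_top[of R] by eventually_elim (rule inv_gap_antimono[OF assms R])
    qed simp
    then have "1 / inv_gap m R \<le> 1 - kappa m"
      using lim(2) inv_gap_ge_1[OF assms R] by (simp add: field_simps)
    then show ?thesis by (simp add: lambda_eq[OF assms R])
  qed
  show "\<exists>g\<in>admissible m R. inf_Phi m R g = lambda m R"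
    using saddle_g_admissible[OF assms R] inf_Phi_saddle_g[OF assms R] lambda_eq[OF assms R] by metis
next
  have "((\<lambda>R. 1 - 1 / inv_gap m R) \<longlongrightarrow> 1 - 1 / (1 / (1 - kappa m))) at_top"
    using inv_gap_tendsto[OF assms] by (intro tendsto_intros) auto
  then have "((\<lambda>R. ereal (1 - 1 / inv_gap m R)) \<longlongrightarrow> ereal (kappa m)) at_top" by simp
  then show "((\<lambda>R. lambda m R) \<longlongrightarrow> ereal (kappa m)) at_top"
    by (rule Lim_transform_eventually)
       (use eventually_gt_at_top[of 0] in eventually_elim, simp add: lambda_eq[OF assms])
qed

end
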